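(* Let $C\subset\mathbb{R}^2$ be a circle centered at the origin $(0,0)$, let $\mathbf{x}_0$ be a point of $C$ lying on the $x$-axis, and let $U$ be an open neighborhood of $C$ with $C\subset U\subset \mathbb{R}^2\setminus\{(0,0)\}$. Let $a>0$ and let $g:U\times(-a,a)\to\mathbb{R}^2$ be continuous and such that (i) $g(\mathbf{r},0)=-\dfrac{\kappa}{\|\mathbf{r}\|^{3}}\,\mathbf{r}$ for all $\mathbf{r}\in U$, where $\kappa>0$ is a constant; (ii) for each $\mu\in(-a,a)$, the map $\mathbf{r}\mapsto g(\mathbf{r},\mu)$ is $C^1$ on $U$; (iii) for all $\mu\in(-a,a)$, $g(\cdot,\mu)$ is invariant (as a vector field) under the reflections $\varphi_1(x,y)=(-x,y)$ and $\varphi_2(x,y)=(x,-y)$; that is, $\varphi_i(U)=U$ and $g(\varphi_i(\mathbf{r}),\mu)=\varphi_i(g(\mathbf{r},\mu))$ for all $\mathbf{r}\in U$, $i=1,2$. Then there is $\delta_0$ with $0<\delta_0<a$ such that for each $\mu\in(-\delta_0,\delta_0)$ there is a velocity $\mathbf{v}_\mu\in\mathbb{R}^2$ for which the solution $\mathbf{r}(t,\mathbf{x}_0,\mathbf{v}_\mu,\mu)$ of $\ddot{\mathbf{r}}=g(\mathbf{r},\mu)$ is periodic. Moreover, given any $\eta>0$, $\delta_0>0$ can be chosen (together with the velocities $\mathbf{v}_\mu$) such that, in addition, (1) for every $\mu\in(-\delta_0,\delta_0)$ the trace of the solution $\mathbf{r}(t,\mathbf{x}_0,\mathbf{v}_\mu,\mu)$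 is a simple closed curve which is symmetric with respect to the $x$-axis and the $y$-axis and encloses the origin; (2) all the velocities $\mathbf{v}_\mu$ are $\eta$-close, i.e. $\|\mathbf{v}_\mu-\mathbf{v}_{\mu'}\|<\eta$ for all $\mu,\mu'\in(-\delta_0,\delta_0)$.
   Context: $\mathbf{r}(t,\mathbf{x},\mathbf{v},\mu)$ denotes the solution of the second order ODE $\ddot{\mathbf{r}}=g(\mathbf{r},\mu)$ with initial conditions $\mathbf{r}(0,\mathbf{x},\mathbf{v},\mu)=\mathbf{x}$ and $\dot{\mathbf{r}}(0,\mathbf{x},\mathbf{v},\mu)=\mathbf{v}$. The trace of a solution is its image in $\mathbb{R}^2$. A simple closed curve $S\subset\mathbb{R}^2$ encloses a point $p\notin S$ if $p$ belongs to the bounded component of $\mathbb{R}^2\setminus S$. *)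

theory Defs
  imports "HOL-Analysis.Analysis"
begin

definition C1_on :: "('a::real_normed_vector \<Rightarrow> 'b::real_normed_vector) \<Rightarrow> 'a set \<Rightarrow> bool" where
  "C1_on f U \<longleftrightarrow>
     (\<exists>f' :: 'a \<Rightarrow> 'a \<Rightarrow>\<^sub>L 'b.
        (\<forall>x\<in>U. (f has_derivative blinfun_apply (f' x)) (at x)) \<and> continuous_on U f')"

definition \<phi>1 :: "real^2 \<Rightarrow> real^2" where
  "\<phi>1 p = vector [- p$1, p$2]"

definition \<phi>2 :: "real^2 \<Rightarrow> real^2" where
  "\<phi>2 p = vector [p$1, - p$2]"

text \<open>The curve \<open>r\<close> is a solution, defined for all time and staying in the domain \<open>U\<close> of \<open>f\<close>,
  of the second order equation \<open>r'' = f(r)\<close> with \<open>r(0) = x\<close> and \<open>r'(0) = v\<close>. For \<open>f\<close> of class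
  \<open>C\<^sup>1\<close> on the open set \<open>U\<close> there is at most one such curve, so that it is the maximal
  solution of the initial value problem.\<close>

definition global_solution ::
  "('a::real_normed_vector \<Rightarrow> 'a) \<Rightarrow> 'a set \<Rightarrow> 'a \<Rightarrow> 'a \<Rightarrow> (real \<Rightarrow> 'a) \<Rightarrow> bool" where
  "global_solution f U x v r \<longleftrightarrow>
     (\<forall>t. r t \<in> U) \<and> r 0 = x \<and>
     (\<exists>r'. r' 0 = v \<and>
        (\<forall>t. (r has_vector_derivative r' t) (at t) \<and>
             (r' has_vector_derivative f (r t)) (at t)))"

definition periodic :: "(real \<Rightarrow> 'a) \<Rightarrow> bool" where
  "periodic r \<longleftrightarrow> (\<exists>T>0. \<forall>t. r (t + T) = r t)"

definition simple_closed_curve :: "'a::topological_space set \<Rightarrow> bool" where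
  "simple_closed_curve S \<longleftrightarrow>
     (\<exists>p. simple_path p \<and> pathfinish p = pathstart p \<and> path_image p = S)"

text \<open>For a simple closed curve \<open>S\<close> in the plane, \<^term>\<open>inside S\<close> is the bounded component
  of the complement of \<open>S\<close>, by the Jordan curve theorem.\<close>

definition encloses :: "(real^2) set \<Rightarrow> real^2 \<Rightarrow> bool" where
  "encloses S p \<longleftrightarrow> p \<in> inside S"

end

theory Submission
  imports Defs
begin

text \<open>Launch the body from \<open>x0\<close>, perpendicularly to the \<open>x\<close>-axis, with a speed \<open>w\<close> close to the
  speed \<open>w0 = sqrt (\<kappa> / R)\<close> of the circular Kepler orbit. The force commutes with the two reflections
  and the equation is reversible in time, so if the orbit also meets the \<open>y\<close>-axis perpendicularly, at
  a time \<open>\<tau>\<close>, then reflecting the arc over \<open>[0, \<tau>]\<close> in the axes produces the whole orbit: it has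
  period \<open>4 * \<tau>\<close> and a trace symmetric in both axes. This is \<open>orbit_from_perpendicular_crossings\<close>.
  Angular momentum of constant sign makes the polar angle of the orbit strictly monotone, and a half
  turn takes exactly the time \<open>2 * \<tau>\<close>; hence every ray from the origin meets the trace exactly once,
  so the trace is a simple closed curve around the origin
  (\<open>antiperiodic_curve_around_origin\<close>).

  It remains to choose \<open>w\<close> so that the crossing is perpendicular. The first component of the
  Laplace-Runge-Lenz vector, \<open>v\<^sub>y * L - \<kappa> * x / norm (x, y)\<close> with \<open>L\<close> the angular momentum, equals
  \<open>v\<^sub>y * L\<close> on the \<open>y\<close>-axis, so the task is to find a time \<open>t\<close> and a speed \<open>w\<close> at which both \<open>x\<close> and
  this component vanish. In the Kepler problem the component is constant along orbits, with the sign
  of \<open>w\<^sup>2 - w0\<^sup>2\<close> up to the sign of \<open>x0\<close>. For small \<open>\<mu>\<close> it therefore still has opposite signs on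
  the two sides \<open>w = w0 - \<epsilon>\<close> and \<open>w = w0 + \<epsilon>\<close> of a rectangle of pairs \<open>(t, w)\<close>, while \<open>x\<close> has
  opposite signs on the two remaining sides, which lie an eighth of a turn before and after the
  crossing of the circular orbit. The Poincare-Miranda theorem (\<open>poincare_miranda_rectangle\<close>) gives
  a common zero (\<open>shooting_from_axis_to_axis\<close>). The argument rests on two continuity properties:
  for fixed \<open>\<mu>\<close> the motion depends continuously on \<open>t\<close> and \<open>w\<close>, and as \<open>\<mu>\<close> tends to 0 the forces,
  and with them the motions on a bounded time interval, converge uniformly.

  The solutions come from the Picard-Lindeloef theorem for globally Lipschitz fields. To apply it,
  the force is cut off outside an annulus around the circle (\<open>annular_extension_of_family\<close>); the
  orbits found stay in the part of the annulus where nothing was changed.\<close>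

section \<open>Ordinary differential equations with a Lipschitz right-hand side\<close>

lemma antiderivative_on_reals:
  fixes h :: "real \<Rightarrow> 'e::euclidean_space"
  assumes "continuous_on UNIV h"
  obtains H where "H 0 = 0" "\<And>t. (H has_vector_derivative h t) (at t)"
proof -
  have "isCont h x" for x
    using assms by (simp add: continuous_on_eq_continuous_at)
  then obtain F where F: "\<forall>x::real. -\<infinity> < ereal x \<longrightarrow> ereal x < \<infinity> \<longrightarrow> (F has_vector_derivative h x) (at x)"
    using einterval_antiderivative[of "-\<infinity>" "\<infinity>" h] by auto
  have "((\<lambda>t. F t - F 0) has_vector_derivative h t) (at t)" for t
    using F by (auto intro!: derivative_eq_intros)
  with that[of "\<lambda>t. F t - F 0"] show thesis by simp
qed

text \<open>The summand \<open>A * t\<close> carries the error term in Gronwall's inequality; with \<open>A = 0\<close> the bound says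
  that integration improves exponential growth of rate \<open>k\<close> by the factor \<open>1 / k\<close>, which is the source
  of the contraction in the existence proof.\<close>

lemma exponential_growth_bound:
  fixes H :: "real \<Rightarrow> 'e::real_normed_vector"
  assumes H: "\<And>s. (H has_vector_derivative h s) (at s)"
    and h: "\<And>s. 0 < s \<Longrightarrow> s < t \<Longrightarrow> norm (h s) \<le> A + C * exp (k * s)"
    and "0 \<le> t" "0 < k" "0 \<le> A" "0 \<le> C"
  shows "norm (H t - H 0) \<le> A * t + C / k * exp (k * t)"
proof (cases "t = 0")
  case True
  then show ?thesis using assms by simp
next
  case False
  have "norm (H t - H 0) \<le> (A * t + C / k * exp (k * t)) - (A * 0 + C / k * exp (k * 0))"
  proof (rule differentiable_bound_general[where \<phi>'="\<lambda>s. A + C * exp (k * s)"])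
    show "continuous_on {0..t} H"
      using H by (meson continuous_at_imp_continuous_on has_vector_derivative_continuous)
    show "((\<lambda>t. A * t + C / k * exp (k * t)) has_vector_derivative A + C * exp (k * s)) (at s)" for s
      unfolding has_real_derivative_iff_has_vector_derivative[symmetric]
      using \<open>0 < k\<close> by (auto intro!: derivative_eq_intros)
  qed (use assms False in \<open>auto intro!: continuous_intros\<close>)
  moreover have "0 \<le> C / k" using assms by simp
  ultimately show ?thesis by simp
qed

lemma exponential_growth_bound_two_sided:
  fixes H :: "real \<Rightarrow> 'e::real_normed_vector"
  assumes H: "\<And>s. (H has_vector_derivative h s) (at s)" and "H 0 = 0"
    and h: "\<And>s. norm (h s) \<le> C * exp (k * \<bar>s\<bar>)" and "0 < k"
  shows "norm (H t) \<le> C / k * exp (k * \<bar>t\<bar>)"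
proof -
  have "norm (h 0) \<le> C" using h[of 0] by simp
  then have C: "0 \<le> C" by (metis norm_ge_zero order_trans)
  show ?thesis
  proof (cases "0 \<le> t")
    case True
    have "norm (h s) \<le> 0 + C * exp (k * s)" if "0 < s" for s
      using h[of s] that by simp
    then have "norm (H t - H 0) \<le> 0 * t + C / k * exp (k * t)"
      by (intro exponential_growth_bound[OF H]) (use True C \<open>0 < k\<close> in auto)
    then show ?thesis using assms(2) True by simp
  next
    case False
    \<comment> \<open>Negative times reduce to positive ones by reversing time.\<close>
    have H': "((\<lambda>s. H (- s)) has_vector_derivative - h (- s)) (at s)" for s
    proof -
      have "(uminus has_vector_derivative -1) (at s)"
        by (auto intro!: derivative_eq_intros)
      from vector_diff_chain_at[OF this H] show ?thesis by (simp add: o_def)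
    qed
    have "norm (- h (- s)) \<le> 0 + C * exp (k * s)" if "0 < s" for s
      using h[of "-s"] that by simp
    then have "norm (H (- (- t)) - H (- 0)) \<le> 0 * (- t) + C / k * exp (k * (- t))"
      by (intro exponential_growth_bound[OF H']) (use False C \<open>0 < k\<close> in auto)
    then show ?thesis using assms(2) False by simp
  qed
qed

text \<open>Picard iteration on the whole real line at once. Writing a solution as \<open>exp (k * \<bar>t\<bar>) *\<^sub>R u t\<close> with
  \<open>u\<close> bounded and \<open>k = 2 * L + 1\<close> makes the Picard operator a contraction with factor 1/2 of the Banach
  space of bounded continuous functions, whose fixed point is a solution for all times.\<close>

lemma lipschitz_ode_global_existence:
  fixes F :: "'e::euclidean_space \<Rightarrow> 'e"
  assumes F: "L-lipschitz_on UNIV F"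
  obtains y where "y 0 = y0" "\<And>t. (y has_vector_derivative F (y t)) (at t)"
proof -
  have L: "0 \<le> L" by (rule lipschitz_on_nonneg[OF F])
  have Lip: "norm (F a - F b) \<le> L * norm (a - b)" for a b
    by (rule lipschitz_on_normD[OF F]) auto
  define k where "k = 2 * L + 1"
  have k: "0 < k" "L / k \<le> 1/2" using L by (auto simp: k_def field_simps)
  define lift where "lift u t = exp (k * \<bar>t\<bar>) *\<^sub>R apply_bcontfun u t" for u :: "real \<Rightarrow>\<^sub>C 'e" and t
  have cF: "continuous_on UNIV F" by (rule lipschitz_on_continuous_on[OF F])
  have "continuous_on UNIV (\<lambda>t. F (lift u t))" for u
    unfolding lift_def
    by (rule continuous_on_compose2[OF cF]) (auto intro!: continuous_intros)
  then have "\<exists>H. H 0 = 0 \<and> (\<forall>t. (H has_vector_derivative F (lift u t)) (at t))" for u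
    by (metis antiderivative_on_reals)
  then obtain W where W0: "\<And>u. W u 0 = 0"
    and W: "\<And>u t. (W u has_vector_derivative F (lift u t)) (at t)" by metis
  have contW: "continuous_on UNIV (W u)" for u
    using W by (meson continuous_at_imp_continuous_on has_vector_derivative_continuous)
  have nlift: "norm (lift u t - lift v t) \<le> exp (k * \<bar>t\<bar>) * dist u v" for u v t
  proof -
    have "lift u t - lift v t = exp (k * \<bar>t\<bar>) *\<^sub>R (apply_bcontfun u t - apply_bcontfun v t)"
      by (simp add: lift_def algebra_simps)
    then show ?thesis
      by (metis abs_exp_cancel dist_bounded dist_norm exp_ge_zero mult_left_mono norm_scaleR)
  qed
  have diffW: "norm (W u t - W v t) \<le> dist u v / 2 * exp (k * \<bar>t\<bar>)" for u v t
  proof -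
    have "norm (W u t - W v t) \<le> (L * dist u v) / k * exp (k * \<bar>t\<bar>)"
    proof (rule exponential_growth_bound_two_sided)
      show "((\<lambda>t. W u t - W v t) has_vector_derivative F (lift u s) - F (lift v s)) (at s)" for s
        by (intro derivative_intros W)
      show "norm (F (lift u s) - F (lift v s)) \<le> L * dist u v * exp (k * \<bar>s\<bar>)" for s
        using order_trans[OF Lip mult_left_mono[OF nlift L]] by (simp add: ac_simps)
    qed (simp_all add: W0 k)
    also have "(L * dist u v) / k = (L / k) * dist u v" by simp
    also have "\<dots> \<le> 1/2 * dist u v" by (intro mult_right_mono k) auto
    finally show ?thesis by simp
  qed
  have boundW: "norm (W u t) \<le> (norm (F 0) + L * norm u) / k * exp (k * \<bar>t\<bar>)" for u t
  proof (rule exponential_growth_bound_two_sided[OF W W0 _ k(1)])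
    fix s
    have "norm (F (lift u s)) \<le> norm (F 0) + L * norm (lift u s)"
      using Lip[of "lift u s" 0] norm_triangle_sub[of "F (lift u s)" "F 0"] by simp
    moreover have "L * norm (lift u s) \<le> L * (exp (k * \<bar>s\<bar>) * norm u)"
      using nlift[of u s 0] L by (intro mult_left_mono) (simp_all add: lift_def)
    moreover have "norm (F 0) \<le> norm (F 0) * exp (k * \<bar>s\<bar>)"
      using mult_left_mono[of 1 "exp (k * \<bar>s\<bar>)" "norm (F 0)"] k by simp
    ultimately show "norm (F (lift u s)) \<le> (norm (F 0) + L * norm u) * exp (k * \<bar>s\<bar>)"
      by (simp add: algebra_simps)
  qed
  \<comment> \<open>The Picard operator, conjugated with the exponential weight.\<close>
  define pic where "pic u t = exp (- (k * \<bar>t\<bar>)) *\<^sub>R (y0 + W u t)" for u t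
  have bc: "pic u \<in> bcontfun" for u
  proof (rule bcontfun_normI)
    show "continuous_on UNIV (pic u)"
      unfolding pic_def by (intro continuous_intros contW)
    fix t
    have "norm (pic u t) \<le> exp (- (k * \<bar>t\<bar>)) * (norm y0 + norm (W u t))"
      by (simp add: pic_def norm_triangle_ineq)
    also have "\<dots> \<le> exp (- (k * \<bar>t\<bar>)) * (norm y0 * exp (k * \<bar>t\<bar>) + (norm (F 0) + L * norm u) / k * exp (k * \<bar>t\<bar>))"
      using boundW[of u t] k by (intro mult_left_mono add_mono) (auto simp: mult_le_cancel_left1)
    also have "\<dots> = norm y0 + (norm (F 0) + L * norm u) / k"
      by (simp add: exp_minus field_simps)
    finally show "norm (pic u t) \<le> norm y0 + (norm (F 0) + L * norm u) / k" .
  qed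
  define P where "P u = Bcontfun (pic u)" for u
  have P: "apply_bcontfun (P u) = pic u" for u
    using bc by (simp add: P_def Bcontfun_inverse)
  have "dist (P u) (P v) \<le> 1/2 * dist u v" for u v
  proof (rule dist_bound)
    fix t
    have "dist (P u t) (P v t) = exp (- (k * \<bar>t\<bar>)) * norm (W u t - W v t)"
      by (simp add: P pic_def dist_norm flip: scaleR_diff_right)
    also have "\<dots> \<le> exp (- (k * \<bar>t\<bar>)) * (dist u v / 2 * exp (k * \<bar>t\<bar>))"
      by (intro mult_left_mono diffW) auto
    also have "\<dots> = 1/2 * dist u v" by (simp add: exp_minus field_simps)
    finally show "dist (P u t) (P v t) \<le> 1/2 * dist u v" .
  qed
  then obtain u where u: "P u = u"
    using banach_fix_type[of "1/2" P] by auto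
  have "lift u t = y0 + W u t" for t
  proof -
    have "lift u t = exp (k * \<bar>t\<bar>) *\<^sub>R pic u t"
      unfolding lift_def by (metis P u)
    also have "\<dots> = y0 + W u t" unfolding pic_def by (simp flip: exp_add)
    finally show ?thesis .
  qed
  then have fixpoint: "lift u = (\<lambda>t. y0 + W u t)" by auto
  show thesis
  proof (rule that)
    show "lift u 0 = y0" by (simp add: fixpoint W0)
    show "(lift u has_vector_derivative F (lift u t)) (at t)" for t
      by (subst fixpoint) (auto intro!: derivative_eq_intros W)
  qed
qed

text \<open>Compare the difference of the curves with the maximum \<open>m\<close> of \<open>exp (- 2 * L * s)\<close> times its norm:
  integrating the hypothesis gives \<open>m \<le> norm (y 0 - z 0) + \<epsilon> * T + m / 2\<close>. The doubled exponent is the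
  price for this short argument.\<close>

lemma gronwall_perturbation:
  fixes y z :: "real \<Rightarrow> 'e::real_normed_vector"
  assumes y: "\<And>s. (y has_vector_derivative y' s) (at s)"
    and z: "\<And>s. (z has_vector_derivative z' s) (at s)"
    and diff: "\<And>s. 0 \<le> s \<Longrightarrow> s \<le> T \<Longrightarrow> norm (y' s - z' s) \<le> \<epsilon> + L * norm (y s - z s)"
    and "0 < L" "0 \<le> T" "0 \<le> \<epsilon>"
  shows "norm (y T - z T) \<le> 2 * (norm (y 0 - z 0) + \<epsilon> * T) * exp (2 * L * T)"
proof -
  define w where "w s = y s - z s" for s
  have w: "(w has_vector_derivative y' s - z' s) (at s)" for s
    unfolding w_def by (intro derivative_intros y z)
  have contw: "continuous_on S w" for S
    using w by (meson continuous_at_imp_continuous_on has_vector_derivative_continuous)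
  define q where "q s = exp (- (2 * L * s)) * norm (w s)" for s
  have "continuous_on {0..T} q"
    unfolding q_def by (intro continuous_intros contw)
  then obtain s0 where s0: "s0 \<in> {0..T}" "\<And>s. s \<in> {0..T} \<Longrightarrow> q s \<le> q s0"
    using continuous_attains_sup[of "{0..T}" q] \<open>0 \<le> T\<close> by auto
  have wq: "norm (w s) = q s * exp (2 * L * s)" for s
    by (simp add: q_def exp_minus field_simps)
  have q0: "0 \<le> q s" for s by (simp add: q_def)
  have "norm (w s0 - w 0) \<le> \<epsilon> * s0 + (L * q s0) / (2 * L) * exp (2 * L * s0)"
  proof (rule exponential_growth_bound[OF w])
    fix s assume s: "0 < s" "s < s0"
    have "norm (y' s - z' s) \<le> \<epsilon> + L * norm (w s)"
      using diff[of s] s s0(1) by (simp add: w_def)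
    also have "norm (w s) \<le> q s0 * exp (2 * L * s)"
      using s0 s by (auto simp: wq intro!: mult_right_mono)
    finally show "norm (y' s - z' s) \<le> \<epsilon> + L * q s0 * exp (2 * L * s)"
      using \<open>0 < L\<close> by (simp add: mult.assoc)
  qed (use s0 assms q0 in auto)
  then have "norm (w s0) \<le> norm (w 0) + \<epsilon> * s0 + q s0 / 2 * exp (2 * L * s0)"
    using norm_triangle_sub[of "w s0" "w 0"] \<open>0 < L\<close> by simp
  then have "q s0 / 2 * exp (2 * L * s0) \<le> norm (w 0) + \<epsilon> * s0"
    by (simp add: wq)
  moreover have "q s0 / 2 * 1 \<le> q s0 / 2 * exp (2 * L * s0)"
    using s0 \<open>0 < L\<close> q0 by (intro mult_left_mono) auto
  moreover have "\<epsilon> * s0 \<le> \<epsilon> * T" using s0 assms by (intro mult_left_mono) auto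
  ultimately have "q s0 / 2 * 1 \<le> norm (w 0) + \<epsilon> * T" by (meson add_left_mono order_trans)
  then have "q s0 \<le> 2 * (norm (w 0) + \<epsilon> * T)" by simp
  then have "q T \<le> 2 * (norm (w 0) + \<epsilon> * T)"
    using s0(2)[of T] \<open>0 \<le> T\<close> by auto
  then have "norm (w T) \<le> 2 * (norm (w 0) + \<epsilon> * T) * exp (2 * L * T)"
    unfolding wq by (intro mult_right_mono) auto
  then show ?thesis by (simp add: w_def)
qed

lemma has_vector_derivative_reversed_time:
  assumes "(y has_vector_derivative d) (at (c - t))"
  shows "((\<lambda>t. y (c - t)) has_vector_derivative - d) (at t)"
proof -
  have "((\<lambda>t. c - t) has_vector_derivative -1) (at t)"
    by (auto intro!: derivative_eq_intros)
  from vector_diff_chain_at[OF this assms] show ?thesis by (simp add: o_def)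
qed

lemma lipschitz_ode_unique:
  fixes y z :: "real \<Rightarrow> 'e::real_normed_vector"
  assumes F: "L-lipschitz_on UNIV F"
    and y: "\<And>t. (y has_vector_derivative F (y t)) (at t)"
    and z: "\<And>t. (z has_vector_derivative F (z t)) (at t)"
    and eq: "y c = z c"
  shows "y = z"
proof
  have Lip: "norm (F a - F b) \<le> (L + 1) * norm (a - b)" for a b
    using lipschitz_on_normD[OF F, of a b]
    by (rule order_trans) (auto intro!: mult_right_mono)
  have L: "0 < L + 1" using lipschitz_on_nonneg[OF F] by simp
  fix t
  show "y t = z t"
  proof (cases "c \<le> t")
    case True
    have sh: "((\<lambda>s. x (c + s)) has_vector_derivative F (x (c + s))) (at s)"
      if "\<And>t. (x has_vector_derivative F (x t)) (at t)" for x s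
    proof -
      have "((\<lambda>s. c + s) has_vector_derivative 1) (at s)"
        by (auto intro!: derivative_eq_intros)
      from vector_diff_chain_at[OF this that] show ?thesis by (simp add: o_def)
    qed
    have "norm (y (c + (t - c)) - z (c + (t - c))) \<le>
        2 * (norm (y (c + 0) - z (c + 0)) + 0 * (t - c)) * exp (2 * (L + 1) * (t - c))"
      by (rule gronwall_perturbation[OF sh[OF y] sh[OF z]]) (use True L Lip in auto)
    then show ?thesis by (simp add: eq)
  next
    case False
    have "norm (y (c - (c - t)) - z (c - (c - t))) \<le>
        2 * (norm (y (c - 0) - z (c - 0)) + 0 * (c - t)) * exp (2 * (L + 1) * (c - t))"
      by (rule gronwall_perturbation[OF has_vector_derivative_reversed_time[OF y]
            has_vector_derivative_reversed_time[OF z]])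
        (use False L Lip in \<open>auto simp: norm_minus_commute\<close>)
    then show ?thesis by (simp add: eq)
  qed
qed

text \<open>Joint continuity holds because the solutions depend on their initial values in a Lipschitz way,
  uniformly in time, while each single solution is continuous in time.\<close>

lemma continuous_on_lipschitz_flow:
  fixes Z :: "real \<Rightarrow> real \<Rightarrow> 'e::euclidean_space"
  assumes F: "L-lipschitz_on UNIV F"
    and Z: "\<And>w t. (Z w has_vector_derivative F (Z w t)) (at t)"
    and init: "continuous_on W (\<lambda>w. Z w 0)" and "0 \<le> A"
  shows "continuous_on ({A..T} \<times> W) (\<lambda>p. Z (snd p) (fst p))"
  unfolding continuous_on_def
proof
  fix p0 assume p0: "p0 \<in> {A..T} \<times> W"
  define K where "K = 2 * exp (2 * (L + 1) * T)"
  have L: "0 < L + 1" using lipschitz_on_nonneg[OF F] by simp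
  have Lip: "norm (F a - F b) \<le> 0 + (L + 1) * norm (a - b)" for a b
  proof -
    have "norm (F a - F b) \<le> L * norm (a - b)" by (rule lipschitz_on_normD[OF F]) auto
    also have "\<dots> \<le> (L + 1) * norm (a - b)" by (intro mult_right_mono) auto
    finally show ?thesis by simp
  qed
  define w0 where "w0 = snd p0"
  have bound: "norm (Z w t - Z w0 t) \<le> K * norm (Z w 0 - Z w0 0)" if "t \<in> {A..T}" for w t
  proof -
    have "norm (Z w t - Z w0 t) \<le> 2 * (norm (Z w 0 - Z w0 0) + 0 * t) * exp (2 * (L + 1) * t)"
      by (rule gronwall_perturbation[OF Z Z Lip L]) (use that \<open>0 \<le> A\<close> in auto)
    also have "\<dots> = norm (Z w 0 - Z w0 0) * (2 * exp (2 * (L + 1) * t))" by simp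
    also have "\<dots> \<le> norm (Z w 0 - Z w0 0) * K"
      unfolding K_def using that L by (intro mult_left_mono) auto
    finally show ?thesis by (simp add: mult.commute)
  qed
  have "continuous_on UNIV (Z w0)"
    using Z by (meson continuous_at_imp_continuous_on has_vector_derivative_continuous)
  then have "continuous_on ({A..T} \<times> W) (\<lambda>p. Z w0 (fst p))"
    by (rule continuous_on_compose2[OF _ continuous_on_fst[OF continuous_on_id]]) auto
  moreover have "continuous_on ({A..T} \<times> W) (\<lambda>p. Z (snd p) 0)"
    by (rule continuous_on_compose2[OF init continuous_on_snd[OF continuous_on_id]]) auto
  ultimately have "continuous_on ({A..T} \<times> W)
      (\<lambda>p. K * norm (Z (snd p) 0 - Z w0 0) + norm (Z w0 (fst p) - Z w0 (fst p0)))"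
    by (intro continuous_intros)
  then have "((\<lambda>p. K * norm (Z (snd p) 0 - Z w0 0) + norm (Z w0 (fst p) - Z w0 (fst p0))) \<longlongrightarrow>
      K * norm (Z (snd p0) 0 - Z w0 0) + norm (Z w0 (fst p0) - Z w0 (fst p0))) (at p0 within {A..T} \<times> W)"
    using p0 unfolding continuous_on_def by blast
  then have lim: "((\<lambda>p. K * norm (Z (snd p) 0 - Z w0 0) + norm (Z w0 (fst p) - Z w0 (fst p0))) \<longlongrightarrow> 0)
      (at p0 within {A..T} \<times> W)" by (simp add: w0_def)
  have "((\<lambda>p. Z (snd p) (fst p) - Z w0 (fst p0)) \<longlongrightarrow> 0) (at p0 within {A..T} \<times> W)"
  proof (rule Lim_null_comparison[OF _ lim])
    have "norm (Z (snd p) (fst p) - Z w0 (fst p0))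
        \<le> K * norm (Z (snd p) 0 - Z w0 0) + norm (Z w0 (fst p) - Z w0 (fst p0))" if "p \<in> {A..T} \<times> W" for p
    proof -
      have "norm (Z (snd p) (fst p) - Z w0 (fst p0))
          \<le> norm (Z (snd p) (fst p) - Z w0 (fst p)) + norm (Z w0 (fst p) - Z w0 (fst p0))"
        using norm_triangle_ineq[of "Z (snd p) (fst p) - Z w0 (fst p)" "Z w0 (fst p) - Z w0 (fst p0)"] by simp
      then show ?thesis using bound[of "fst p" "snd p"] that by auto
    qed
    then show "\<forall>\<^sub>F p in at p0 within {A..T} \<times> W. norm (Z (snd p) (fst p) - Z w0 (fst p0))
        \<le> K * norm (Z (snd p) 0 - Z w0 0) + norm (Z w0 (fst p) - Z w0 (fst p0))"
      by (auto simp: eventually_at_filter)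
  qed
  then show "((\<lambda>p. Z (snd p) (fst p)) \<longlongrightarrow> Z (snd p0) (fst p0)) (at p0 within {A..T} \<times> W)"
    unfolding w0_def by (rule Lim_null[THEN iffD2])
qed

section \<open>Closed plane curves met once by every ray from the origin\<close>

lemma periodic_reduce:
  fixes f :: "real \<Rightarrow> 'a"
  assumes "\<And>t. f (t + P) = f t" "0 < P"
  obtains s where "s \<in> {0..<P}" "f t = f s"
proof -
  interpret periodic_fun_simple f P by unfold_locales (rule assms(1))
  have "frac (t / P) * P = t - of_int \<lfloor>t / P\<rfloor> * P"
    using \<open>0 < P\<close> by (simp add: frac_def field_simps)
  then have "f t = f (frac (t / P) * P)"
    using minus_of_int by simp
  moreover have "frac (t / P) * P \<in> {0..<P}"
    using \<open>0 < P\<close> frac_lt_1[of "t / P"] frac_ge_0[of "t / P"] by auto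
  ultimately show thesis using that by blast
qed

text \<open>The signed area spanned by two plane vectors; applied to position and velocity it is the angular
  momentum.\<close>

definition cross :: "real^2 \<Rightarrow> real^2 \<Rightarrow> real" where
  "cross p q = p$1 * q$2 - p$2 * q$1"

lemma cross_simps [simp]:
  "cross (c *\<^sub>R p) q = c * cross p q" "cross p (c *\<^sub>R q) = c * cross p q"
  "cross (- p) q = - cross p q" "cross p (- q) = - cross p q" "cross p p = 0"
  "cross 0 q = 0" "cross p 0 = 0"
  by (simp_all add: cross_def algebra_simps)

lemma cross_skew: "cross q p = - cross p q"
  by (simp add: cross_def)

lemma continuous_on_cross [continuous_intros]:
  "continuous_on S f \<Longrightarrow> continuous_on S g \<Longrightarrow> continuous_on S (\<lambda>x. cross (f x) (g x))"
  unfolding cross_def by (intro continuous_intros)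

lemma cross_eq_0_imp_parallel:
  assumes "cross p q = 0" "p \<noteq> 0" "q \<noteq> 0"
  obtains c where "c \<noteq> 0" "q = c *\<^sub>R p"
proof -
  have eq: "p$1 * q$2 = p$2 * q$1" using assms(1) by (simp add: cross_def)
  have "\<exists>c. q = c *\<^sub>R p"
  proof (cases "p$1 = 0")
    case True
    then have "p$2 \<noteq> 0" using assms(2) by (auto simp: vec_eq_iff forall_2)
    with True eq have "q = (q$2 / p$2) *\<^sub>R p" by (auto simp: vec_eq_iff forall_2)
    then show ?thesis by blast
  next
    case False
    with eq have "q = (q$1 / p$1) *\<^sub>R p" by (auto simp: vec_eq_iff forall_2 field_simps)
    then show ?thesis by blast
  qed
  with that assms(3) show thesis by (metis scaleR_zero_left)
qed

lemma abs_cross_le: "\<bar>cross p q\<bar> \<le> 2 * (norm p * norm q)"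
proof -
  have c: "\<bar>p $ i\<bar> \<le> norm p" "\<bar>q $ i\<bar> \<le> norm q" for i by (rule component_le_norm_cart)+
  have "\<bar>p $ 1 * q $ 2\<bar> \<le> norm p * norm q" "\<bar>p $ 2 * q $ 1\<bar> \<le> norm p * norm q"
    unfolding abs_mult by (intro mult_mono c; simp)+
  then show ?thesis unfolding cross_def by linarith
qed

text \<open>In a convergent sequence \<open>s n *\<^sub>R q n\<close> a subsequence of the \<open>q n\<close> converges in \<open>S\<close>, and then so do
  the \<open>s n\<close>, being quotients of norms.\<close>

lemma closed_outer_rays:
  fixes S :: "'a::real_normed_vector set"
  assumes "compact S" "0 \<notin> S"
  shows "closed {s *\<^sub>R q | s q. 1 \<le> s \<and> q \<in> S}"
  unfolding closed_sequential_limits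
proof (intro allI impI, elim conjE)
  fix p l assume p: "\<forall>n. p n \<in> {s *\<^sub>R q | s q. 1 \<le> s \<and> q \<in> S}" and l: "p \<longlonglongrightarrow> l"
  then have "\<forall>n. \<exists>s q. p n = s *\<^sub>R q \<and> 1 \<le> s \<and> q \<in> S" by blast
  then obtain s q where sq: "\<And>n. p n = s n *\<^sub>R q n" "\<And>n. 1 \<le> s n" "\<And>n. q n \<in> S"
    by metis
  obtain k q' where q': "q' \<in> S" "strict_mono k" "(q \<circ> k) \<longlonglongrightarrow> q'"
    using assms(1) sq(3) unfolding compact_def by metis
  have q0: "q' \<noteq> 0" using q' assms by auto
  have pk: "(p \<circ> k) \<longlonglongrightarrow> l" by (rule LIMSEQ_subseq_LIMSEQ[OF l q'(2)])
  have s: "s n = norm (p n) / norm (q n)" for n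
    using sq(2)[of n] sq(3)[of n] assms(2) by (auto simp: sq(1))
  have "(\<lambda>n. norm ((p \<circ> k) n) / norm ((q \<circ> k) n)) \<longlonglongrightarrow> norm l / norm q'"
    using q0 by (intro tendsto_intros pk q'(3)) auto
  then have sk: "(\<lambda>n. s (k n)) \<longlonglongrightarrow> norm l / norm q'" by (simp add: s)
  have "1 \<le> norm l / norm q'"
    by (rule LIMSEQ_le_const[OF sk]) (use sq(2) in auto)
  moreover have "(p \<circ> k) \<longlonglongrightarrow> (norm l / norm q') *\<^sub>R q'"
    using tendsto_scaleR[OF sk q'(3)] by (simp add: o_def sq(1))
  then have "l = (norm l / norm q') *\<^sub>R q'"
    using pk LIMSEQ_unique by blast
  ultimately show "l \<in> {s *\<^sub>R q | s q. 1 \<le> s \<and> q \<in> S}" using q'(1) by blast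
qed

text \<open>The cone \<open>K\<close> over \<open>S\<close> with apex 0 and the set \<open>V\<close> of points on or beyond \<open>S\<close> are closed, cover the
  space and meet only in \<open>S\<close>. Hence their complements separate the complement of \<open>S\<close>, and the
  component of 0 stays in the bounded set \<open>K\<close>.\<close>

lemma zero_inside_star_shaped_curve:
  fixes S :: "'a::real_normed_vector set"
  assumes S: "compact S" "0 \<notin> S" "S \<noteq> {}"
    and hit: "\<And>d. d \<noteq> 0 \<Longrightarrow> \<exists>q\<in>S. \<exists>c>0. d = c *\<^sub>R q"
    and once: "\<And>q q' c. q \<in> S \<Longrightarrow> q' \<in> S \<Longrightarrow> 0 < c \<Longrightarrow> q = c *\<^sub>R q' \<Longrightarrow> q = q'"
  shows "0 \<in> inside S"
proof -
  define K where "K = (\<lambda>(s, q). s *\<^sub>R q) ` ({0..1} \<times> S)"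
  define V where "V = {s *\<^sub>R q | s q. 1 \<le> s \<and> q \<in> S}"
  define C where "C = connected_component_set (- S) 0"
  have "compact K"
    unfolding K_def
    by (rule compact_continuous_image)
      (auto intro!: continuous_intros compact_Times S simp: case_prod_beta)
  have "closed V" unfolding V_def by (rule closed_outer_rays[OF S(1,2)])
  have "0 \<notin> V" using S(2) unfolding V_def by auto
  have "0 \<in> K" using S(3) unfolding K_def by force
  have cover: "p \<in> K \<or> p \<in> V" for p
  proof (cases "p = 0")
    case False
    then obtain q c where q: "q \<in> S" "c > 0" "p = c *\<^sub>R q" using hit by blast
    show ?thesis
    proof (cases "c \<le> 1")
      case True
      then have "p \<in> K" unfolding K_def using q by (intro image_eqI[of _ _ "(c, q)"]) auto
      then show ?thesis ..
    next
      case False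
      then show ?thesis using q unfolding V_def by force
    qed
  qed (use \<open>0 \<in> K\<close> in auto)
  have meet: "p \<in> S" if "p \<in> K" "p \<in> V" for p
  proof -
    obtain s q where s: "0 \<le> s" "s \<le> 1" "q \<in> S" "p = s *\<^sub>R q"
      using \<open>p \<in> K\<close> unfolding K_def by auto
    obtain s' q' where s': "1 \<le> s'" "q' \<in> S" "p = s' *\<^sub>R q'"
      using \<open>p \<in> V\<close> unfolding V_def by auto
    have "s \<noteq> 0" using s(4) s' S(2) by auto
    then have "q = (s' / s) *\<^sub>R q'"
      using s(4) s'(3) by (metis divideR_right scaleR_scaleR divide_inverse_commute)
    then have "q = q'" using once s s' \<open>s \<noteq> 0\<close> by (metis divide_pos_pos less_le less_le_trans zero_less_one)
    then have "s = s'" using s(4) s'(3) S(2) s'(2) by (metis scaleR_cancel_right)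
    then have "p = q" using s s' by simp
    then show ?thesis using s by simp
  qed
  have "C \<subseteq> K"
  proof -
    have "connected C" unfolding C_def by (rule connected_connected_component)
    moreover have "open (- V)" "open (- K)"
      using \<open>closed V\<close> \<open>compact K\<close> compact_imp_closed by blast+
    moreover have "- V \<inter> - K \<inter> C = {}" using cover by blast
    moreover have "C \<subseteq> - V \<union> - K"
      using connected_component_subset[of "- S" 0] meet unfolding C_def by blast
    ultimately have "- V \<inter> C = {} \<or> - K \<inter> C = {}"
      by (rule connectedD)
    moreover have "0 \<in> C" using S(2) unfolding C_def by (simp add: connected_component_refl)
    ultimately show ?thesis using \<open>0 \<notin> V\<close> by blast
  qed
  then have "bounded C" using \<open>compact K\<close> by (meson bounded_subset compact_imp_bounded)
  then show ?thesis using S(2) unfolding inside_def C_def by simp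
qed

text \<open>By the hypothesis on \<open>cross\<close>, no line through the origin is met twice during the half period
  \<open>[0, h)\<close>, and the second half is the point reflection of the first, so each ray is met at most once
  in a full period. Each ray is met, since \<open>cross (r t) d\<close> changes sign between \<open>0\<close> and \<open>h\<close>.\<close>

lemma antiperiodic_curve_around_origin:
  fixes r :: "real \<Rightarrow> real^2"
  assumes cont: "continuous_on UNIV r" and "0 < h"
    and anti: "\<And>t. r (t + h) = - r t"
    and cross: "\<And>s t. 0 \<le> s \<Longrightarrow> s < t \<Longrightarrow> t < h \<Longrightarrow> cross (r s) (r t) \<noteq> 0"
  shows "simple_closed_curve (range r)" and "encloses (range r) 0"
proof -
  have per: "r (t + 2 * h) = r t" for t
    using anti[of "t + h"] anti[of t] by (simp add: algebra_simps)
  have reduce: "\<exists>s\<in>{0..<2*h}. r t = r s" for t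
    by (rule periodic_reduce[of r "2 * h" t]) (use per \<open>0 < h\<close> in auto)
  have half: "\<exists>s\<in>{0..<h}. (t = s \<and> r t = r s) \<or> (t = s + h \<and> r t = - r s)" if "t \<in> {0..<2*h}" for t
  proof (cases "t < h")
    case True
    then show ?thesis using that by auto
  next
    case False
    then show ?thesis using that anti[of "t - h"] by (intro bexI[of _ "t - h"]) auto
  qed
  have nz0: "r s \<noteq> 0" if s: "s \<in> {0..<h}" for s
  proof
    assume 0: "r s = 0"
    show False
    proof (cases "s = 0")
      case True
      then show False using cross[of 0 "h/2"] 0 \<open>0 < h\<close> by simp
    next
      case False
      then show False using cross[of 0 s] 0 s by simp
    qed
  qed
  have nz: "r t \<noteq> 0" for t
    using reduce[of t] half nz0 by (metis neg_equal_0_iff_equal)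
  have once: "t = t'"
    if t: "t \<in> {0..<2*h}" and t': "t' \<in> {0..<2*h}" and c: "0 < c" and eq: "r t = c *\<^sub>R r t'" for t t' c
  proof -
    obtain s where s: "s \<in> {0..<h}" "(t = s \<and> r t = r s) \<or> (t = s + h \<and> r t = - r s)"
      using half[OF t] by blast
    obtain s' where s': "s' \<in> {0..<h}" "(t' = s' \<and> r t' = r s') \<or> (t' = s' + h \<and> r t' = - r s')"
      using half[OF t'] by blast
    have "cross (r t) (r t') = 0" by (subst eq) simp
    then have "cross (r s) (r s') = 0" using s(2) s'(2) by auto
    then have "s = s'"
      using cross[of s s'] cross[of s' s] cross_skew[of "r s" "r s'"] s(1) s'(1)
      by (cases s s' rule: linorder_cases) auto
    have opposite: "r s + c *\<^sub>R r s \<noteq> 0"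
    proof
      assume "r s + c *\<^sub>R r s = 0"
      then have "(1 + c) *\<^sub>R r s = 0" by (simp add: scaleR_add_left)
      then show False using c nz[of s] by simp
    qed
    consider "t = t'" | "r t = r s" "r t' = - r s" | "r t = - r s" "r t' = r s"
      using s(2) s'(2) \<open>s = s'\<close> by metis
    then show ?thesis
    proof cases
      case 2
      then show ?thesis using eq opposite by (metis add.left_inverse add.commute scaleR_minus_right)
    next
      case 3
      then show ?thesis using eq opposite by (metis add.right_inverse)
    qed
  qed
  have hit: "\<exists>t. \<exists>c>0. d = c *\<^sub>R r t" if d: "d \<noteq> 0" for d
  proof -
    have contc: "continuous_on {0..h} (\<lambda>t. cross (r t) d)"
      by (intro continuous_intros continuous_on_subset[OF cont]) auto
    have "r h = - r 0" using anti[of 0] by simp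
    then have h: "cross (r h) d = - cross (r 0) d" by simp
    have "\<exists>t. cross (r t) d = 0"
    proof (cases "cross (r 0) d \<le> 0")
      case True
      then show ?thesis using IVT'[of "\<lambda>t. cross (r t) d" 0 0 h] contc h \<open>0 < h\<close> by auto
    next
      case False
      then show ?thesis using IVT2'[of "\<lambda>t. cross (r t) d" h 0 0] contc h \<open>0 < h\<close> by auto
    qed
    then obtain t where "cross (r t) d = 0" by blast
    from cross_eq_0_imp_parallel[OF this nz d] obtain c where c: "c \<noteq> 0" "d = c *\<^sub>R r t" .
    show ?thesis
    proof (cases "c > 0")
      case True
      then show ?thesis using c by blast
    next
      case False
      then have "d = (- c) *\<^sub>R r (t + h)" "- c > 0" using c anti by auto
      then show ?thesis by blast
    qed
  qed
  have range: "range r = r ` {0..2*h}"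
  proof
    show "range r \<subseteq> r ` {0..2*h}"
      using reduce by (force simp: image_iff)
  qed auto
  define p where "p u = r (2 * h * u)" for u
  have im: "path_image p = range r"
  proof -
    have "(\<lambda>u. 2 * h * u) ` {0..1} = {0..2*h}"
      using \<open>0 < h\<close> image_mult_atLeastAtMost[of "2*h" 0 1] by simp
    then show ?thesis unfolding range path_image_def p_def
      by (metis image_image)
  qed
  have ends: "p 0 = r 0" "p 1 = r 0" using per[of 0] by (simp_all add: p_def)
  have "simple_path p"
    unfolding simple_path_def loop_free_def
  proof (intro conjI ballI impI)
    show "path p" unfolding path_def p_def
      by (intro continuous_on_compose2[OF cont] continuous_intros) auto
    fix x y :: real assume xy: "x \<in> {0..1}" "y \<in> {0..1}" "p x = p y"
    have inj: "x = y" if "x \<in> {0..<1}" "y \<in> {0..<1}" "p x = p y" for x y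
    proof -
      have "2 * h * x = 2 * h * y"
        by (rule once[of _ _ 1]) (use that \<open>0 < h\<close> in \<open>auto simp: p_def\<close>)
      then show ?thesis using \<open>0 < h\<close> by simp
    qed
    show "x = y \<or> x = 0 \<and> y = 1 \<or> x = 1 \<and> y = 0"
    proof (cases "x = 1")
      case True
      have "y = 0" if "y \<noteq> 1"
        by (rule inj) (use that True xy(2) xy(3)[symmetric] ends in simp_all)
      with True show ?thesis by blast
    next
      case False
      have "x = 0" if "y = 1"
        by (rule inj) (use that False xy ends in simp_all)
      moreover have "x = y" if "y \<noteq> 1"
        by (rule inj) (use that False xy in simp_all)
      ultimately show ?thesis by blast
    qed
  qed
  moreover have "pathfinish p = pathstart p" by (simp add: pathfinish_def pathstart_def ends)
  ultimately show "simple_closed_curve (range r)"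
    unfolding simple_closed_curve_def using im by blast
  have "0 \<in> inside (range r)"
  proof (rule zero_inside_star_shaped_curve)
    show "compact (range r)" unfolding range
      by (intro compact_continuous_image continuous_on_subset[OF cont]) auto
    show "0 \<notin> range r" using nz by (metis rangeE)
    show "\<exists>q\<in>range r. \<exists>c>0. d = c *\<^sub>R q" if "d \<noteq> 0" for d using hit[OF that] by blast
    show "q = q'" if "q \<in> range r" "q' \<in> range r" "0 < c" "q = c *\<^sub>R q'" for q q' c
    proof -
      obtain t t' where "t \<in> {0..<2*h}" "t' \<in> {0..<2*h}" "q = r t" "q' = r t'"
        using \<open>q \<in> range r\<close> \<open>q' \<in> range r\<close> reduce by (metis rangeE)
      then show ?thesis using once that by metis
    qed
  qed auto
  then show "encloses (range r) 0" unfolding encloses_def .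
qed

section \<open>Common zeros of two functions on a rectangle\<close>

text \<open>Brouwer's theorem for the map that moves \<open>p\<close> by \<open>- (f p, g p)\<close> and then projects back to the
  rectangle: at a fixed point a non-zero coordinate of the displacement would have to be cancelled by
  the projection, which the boundary signs exclude.\<close>

lemma poincare_miranda_rectangle:
  fixes f g :: "real \<times> real \<Rightarrow> real"
  assumes cont: "continuous_on ({a..b} \<times> {c..d}) f" "continuous_on ({a..b} \<times> {c..d}) g"
    and "a \<le> b" "c \<le> d"
    and f: "\<And>y. y \<in> {c..d} \<Longrightarrow> f (a, y) \<le> 0" "\<And>y. y \<in> {c..d} \<Longrightarrow> 0 \<le> f (b, y)"
    and g: "\<And>x. x \<in> {a..b} \<Longrightarrow> g (x, c) \<le> 0" "\<And>x. x \<in> {a..b} \<Longrightarrow> 0 \<le> g (x, d)"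
  obtains x y where "x \<in> {a..b}" "y \<in> {c..d}" "f (x, y) = 0" "g (x, y) = 0"
proof -
  define push where
    "push p = (max a (min b (fst p - f p)), max c (min d (snd p - g p)))" for p
  have "continuous_on ({a..b} \<times> {c..d}) push"
    unfolding push_def by (intro continuous_intros cont)
  moreover have "push \<in> {a..b} \<times> {c..d} \<rightarrow> {a..b} \<times> {c..d}"
    using assms(3,4) by (auto simp: push_def)
  moreover have "compact ({a..b} \<times> {c..d})" "convex ({a..b} \<times> {c..d})" "{a..b} \<times> {c..d} \<noteq> {}"
    using assms(3,4) by (auto intro: compact_Times convex_Times)
  ultimately obtain p where p: "p \<in> {a..b} \<times> {c..d}" "push p = p"
    using brouwer by metis
  obtain x y where xy: "p = (x, y)" "x \<in> {a..b}" "y \<in> {c..d}" using p by auto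
  have *: "max a (min b (x - f (x, y))) = x" "max c (min d (y - g (x, y))) = y"
    using p(2) by (auto simp: push_def xy)
  have "f (x, y) = 0"
    using *(1) f[OF xy(3)] xy(2) by (auto simp: max_def min_def split: if_splits)
  moreover have "g (x, y) = 0"
    using *(2) g[OF xy(2)] xy(3) by (auto simp: max_def min_def split: if_splits)
  ultimately show thesis using that xy by blast
qed

section \<open>Newton's equation and its reversing reflections\<close>

text \<open>The first order system on pairs of position and velocity that is equivalent to \<open>r'' = f r\<close>.\<close>

definition newton :: "('a \<Rightarrow> 'a) \<Rightarrow> 'a \<times> 'a \<Rightarrow> 'a \<times> 'a" where
  "newton f z = (snd z, f (fst z))"

lemma lipschitz_on_newton:
  fixes f :: "'a::real_normed_vector \<Rightarrow> 'a"
  assumes "M-lipschitz_on UNIV f"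
  shows "(M + 1)-lipschitz_on UNIV (newton f)"
proof (rule lipschitz_onI)
  have "0 \<le> M" using assms lipschitz_on_nonneg by blast
  then show "0 \<le> M + 1" by simp
  fix z z' :: "'a \<times> 'a"
  have "dist (newton f z) (newton f z') \<le> norm (snd z - snd z') + norm (f (fst z) - f (fst z'))"
    unfolding newton_def dist_norm minus_prod_def using norm_Pair_le by auto
  also have "norm (snd z - snd z') \<le> norm (z - z')"
    using norm_snd_le[of "snd z - snd z'" "fst z - fst z'"] by (simp add: minus_prod_def)
  also have "norm (f (fst z) - f (fst z')) \<le> M * norm (fst z - fst z')"
    by (rule lipschitz_on_normD[OF assms]) auto
  also have "M * norm (fst z - fst z') \<le> M * norm (z - z')"
    using norm_fst_le[of "fst z - fst z'" "snd z - snd z'"] \<open>0 \<le> M\<close>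
    by (intro mult_left_mono) (simp_all add: minus_prod_def)
  finally show "dist (newton f z) (newton f z') \<le> (M + 1) * dist z z'"
    by (simp add: dist_norm algebra_simps)
qed

lemma newton_position_velocity:
  assumes "(z has_vector_derivative newton f (z t)) (at t)"
  shows "((\<lambda>t. fst (z t)) has_vector_derivative snd (z t)) (at t)"
    and "((\<lambda>t. snd (z t)) has_vector_derivative f (fst (z t))) (at t)"
  using bounded_linear.has_vector_derivative[OF bounded_linear_fst assms]
    bounded_linear.has_vector_derivative[OF bounded_linear_snd assms]
  by (simp_all add: newton_def)

lemma newton_components:
  fixes z :: "real \<Rightarrow> (real^'n) \<times> (real^'n)"
  assumes "(z has_vector_derivative newton f (z t)) (at t)"
  shows "((\<lambda>t. fst (z t) $ i) has_real_derivative snd (z t) $ i) (at t)"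
    and "((\<lambda>t. snd (z t) $ i) has_real_derivative f (fst (z t)) $ i) (at t)"
  using newton_position_velocity[OF assms, THEN bounded_linear.has_vector_derivative[OF bounded_linear_vec_nth]]
  by (simp_all add: has_real_derivative_iff_has_vector_derivative)

text \<open>The rate of growth is that of the unperturbed force \<open>f0\<close>, so the estimate is uniform in \<open>f\<close>; this
  matters for families of forces without a common Lipschitz constant.\<close>

lemma newton_family_perturbation:
  fixes f f0 :: "'a::euclidean_space \<Rightarrow> 'a"
  assumes f0: "M-lipschitz_on UNIV f0"
    and near: "\<And>p. norm (f p - f0 p) \<le> \<epsilon>" "0 \<le> \<epsilon>"
    and z: "\<And>t. (z has_vector_derivative newton f (z t)) (at t)"
    and z0: "\<And>t. (z0 has_vector_derivative newton f0 (z0 t)) (at t)"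
    and t: "0 \<le> t" "t \<le> T"
  shows "norm (z t - z0 t) \<le> 2 * exp (2 * (M + 1) * T) * (norm (z 0 - z0 0) + \<epsilon> * T)"
proof -
  have M: "0 < M + 1" using lipschitz_on_nonneg[OF f0] by simp
  have "norm (newton f a - newton f0 b) \<le> \<epsilon> + (M + 1) * norm (a - b)" for a b
  proof -
    have "newton f a - newton f0 a = (0, f (fst a) - f0 (fst a))" by (simp add: newton_def minus_prod_def)
    then have "norm (newton f a - newton f0 a) \<le> \<epsilon>" using near(1) by (simp add: norm_Pair)
    moreover have "norm (newton f0 a - newton f0 b) \<le> (M + 1) * norm (a - b)"
      by (rule lipschitz_on_normD[OF lipschitz_on_newton[OF f0]]) auto
    ultimately show ?thesis
      using norm_triangle_ineq[of "newton f a - newton f0 a" "newton f0 a - newton f0 b"] by simp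
  qed
  then have "norm (z t - z0 t) \<le> 2 * (norm (z 0 - z0 0) + \<epsilon> * t) * exp (2 * (M + 1) * t)"
    by (intro gronwall_perturbation[OF z z0 _ M t(1) near(2)])
  also have "\<dots> \<le> 2 * (norm (z 0 - z0 0) + \<epsilon> * T) * exp (2 * (M + 1) * T)"
    using t M near(2) by (intro mult_mono add_mono mult_left_mono add_nonneg_nonneg) auto
  finally show ?thesis by (simp only: ac_simps)
qed

text \<open>Reflecting an orbit and running it backwards gives an orbit again. If the two share position and
  velocity at the time \<open>k\<close>, which happens when the velocity is perpendicular to the mirror there,
  uniqueness makes them equal.\<close>

lemma newton_time_reversal:
  fixes z :: "real \<Rightarrow> 'a::real_normed_vector \<times> 'a"
  assumes f: "M-lipschitz_on UNIV f" and z: "\<And>t. (z has_vector_derivative newton f (z t)) (at t)"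
    and \<phi>: "bounded_linear \<phi>" "\<And>p. f (\<phi> p) = \<phi> (f p)"
    and k: "\<phi> (fst (z k)) = fst (z k)" "\<phi> (snd (z k)) = - snd (z k)"
  shows "fst (z (2 * k - t)) = \<phi> (fst (z t))" "snd (z (2 * k - t)) = - \<phi> (snd (z t))"
proof -
  interpret bounded_linear \<phi> by (rule \<phi>)
  define w where "w t = (\<phi> (fst (z (2 * k - t))), - \<phi> (snd (z (2 * k - t))))" for t
  have "(w has_vector_derivative newton f (w t)) (at t)" for t
  proof -
    have "((\<lambda>t. fst (z (2 * k - t))) has_vector_derivative - snd (z (2 * k - t))) (at t)"
      "((\<lambda>t. snd (z (2 * k - t))) has_vector_derivative - f (fst (z (2 * k - t)))) (at t)"
      using has_vector_derivative_reversed_time[OF newton_position_velocity(1)[OF z]]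
        has_vector_derivative_reversed_time[OF newton_position_velocity(2)[OF z]] by simp_all
    then have "(w has_vector_derivative
        (\<phi> (- snd (z (2 * k - t))), - \<phi> (- f (fst (z (2 * k - t)))))) (at t)"
      unfolding w_def
      by (intro has_vector_derivative_Pair has_vector_derivative_minus has_vector_derivative)
    then show ?thesis by (simp add: newton_def w_def neg \<phi>(2))
  qed
  moreover have "w k = z k" by (simp add: w_def k)
  ultimately have "w = z"
    using lipschitz_ode_unique[OF lipschitz_on_newton[OF f], of w z k] z by blast
  then have "z (2 * k - t) = w (2 * k - t)" by simp
  then show "fst (z (2 * k - t)) = \<phi> (fst (z t))" "snd (z (2 * k - t)) = - \<phi> (snd (z t))"
    by (simp_all add: w_def)
qed

lemma reflection_nth [simp]: "\<phi>1 p $ 1 = - p $ 1" "\<phi>1 p $ 2 = p $ 2" "\<phi>2 p $ 1 = p $ 1" "\<phi>2 p $ 2 = - p $ 2"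
  by (simp_all add: \<phi>1_def \<phi>2_def)

lemma reflection_involution [simp]: "\<phi>1 (\<phi>1 p) = p" "\<phi>2 (\<phi>2 p) = p"
  by (simp_all add: vec_eq_iff forall_2)

lemma bounded_linear_reflection: "bounded_linear \<phi>1" "bounded_linear \<phi>2"
  by (intro linear_conv_bounded_linear[THEN iffD1] linearI; simp add: vec_eq_iff forall_2)+

lemma norm_real2: "norm (p :: real^2) = sqrt ((p$1)\<^sup>2 + (p$2)\<^sup>2)"
  by (simp add: norm_vec_def L2_set_def sum_2)

lemma norm_reflection [simp]: "norm (\<phi>1 p) = norm p" "norm (\<phi>2 p) = norm p"
  by (simp_all add: norm_real2)

lemma cross_reflection [simp]: "cross (\<phi>1 p) (\<phi>1 q) = - cross p q" "cross (\<phi>2 p) (\<phi>2 q) = - cross p q"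
  by (simp_all add: cross_def)

lemma image_range_involution:
  assumes f: "\<And>t. f (r t) = r (k t)" "\<And>p. f (f p) = p"
  shows "f ` range r = range r"
proof
  show "f ` range r \<subseteq> range r" using f(1) by auto
  show "range r \<subseteq> f ` range r"
  proof
    fix p assume "p \<in> range r"
    then have "f p \<in> range r" using f(1) by auto
    then have "f (f p) \<in> f ` range r" by (rule imageI)
    then show "p \<in> f ` range r" by (simp add: f(2))
  qed
qed

text \<open>Time reversal at \<open>0\<close> with \<open>\<phi>2\<close> and at \<open>\<tau>\<close> with \<open>\<phi>1\<close> gives \<open>r (- t) = \<phi>2 (r t)\<close> and
  \<open>r (2 * \<tau> - t) = \<phi>1 (r t)\<close>, hence \<open>r (t + 2 * \<tau>) = - r t\<close>. The condition \<open>spin\<close> on the angular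
  momentum, multiplied by the first coordinate of the starting point to cover both orientations, makes
  the quotient of the coordinates monotone on \<open>(0, 2 * \<tau>)\<close>, so no line through the origin is met
  twice there.\<close>

lemma orbit_from_perpendicular_crossings:
  fixes z :: "real \<Rightarrow> (real^2) \<times> (real^2)"
  defines "r \<equiv> \<lambda>t. fst (z t)"
  assumes f: "M-lipschitz_on UNIV f" and sym: "\<And>p. f (\<phi>1 p) = \<phi>1 (f p)" "\<And>p. f (\<phi>2 p) = \<phi>2 (f p)"
    and z: "\<And>t. (z has_vector_derivative newton f (z t)) (at t)"
    and start: "r 0 $ 2 = 0" "snd (z 0) $ 1 = 0"
    and turn: "0 < \<tau>" "r \<tau> $ 1 = 0" "snd (z \<tau>) $ 2 = 0"
    and up: "\<And>t. 0 < t \<Longrightarrow> t \<le> \<tau> \<Longrightarrow> 0 < r t $ 2"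
    and spin: "\<And>t. 0 \<le> t \<Longrightarrow> t \<le> \<tau> \<Longrightarrow> 0 < r 0 $ 1 * cross (r t) (snd (z t))"
  shows "\<And>t. \<exists>s\<in>{0..\<tau>}. norm (r t) = norm (r s)"
    and "periodic r" "\<phi>1 ` range r = range r" "\<phi>2 ` range r = range r"
    and "simple_closed_curve (range r)" "encloses (range r) 0"
proof -
  have r2: "r (- t) = \<phi>2 (r t)" for t
    using newton_time_reversal(1)[OF f z bounded_linear_reflection(2) sym(2), of 0] start
    by (simp add: r_def vec_eq_iff forall_2)
  have r1: "r (2 * \<tau> - t) = \<phi>1 (r t)" "snd (z (2 * \<tau> - t)) = - \<phi>1 (snd (z t))" for t
    using newton_time_reversal[OF f z bounded_linear_reflection(1) sym(1), of \<tau>] turn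
    by (simp_all add: r_def vec_eq_iff forall_2)
  have anti: "r (t + 2 * \<tau>) = - r t" for t
    using r1(1)[of "- t"] r2[of t] by (simp add: vec_eq_iff forall_2 add.commute)
  have cont: "continuous_on UNIV r"
    unfolding r_def using newton_position_velocity(1)[OF z]
    by (meson continuous_at_imp_continuous_on has_vector_derivative_continuous)
  show "\<exists>s\<in>{0..\<tau>}. norm (r t) = norm (r s)" for t
  proof -
    obtain s where s: "s \<in> {0..<2 * \<tau>}" "norm (r t) = norm (r s)"
      using periodic_reduce[of "\<lambda>t. norm (r t)" "2 * \<tau>" t] anti turn(1) by auto
    show ?thesis
    proof (cases "s \<le> \<tau>")
      case True
      then show ?thesis using s by auto
    next
      case False
      then have "2 * \<tau> - s \<in> {0..\<tau>}" using s by auto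
      moreover have "norm (r s) = norm (r (2 * \<tau> - s))" by (simp add: r1)
      ultimately show ?thesis using s by metis
    qed
  qed
  show "periodic r"
    unfolding periodic_def
  proof (intro exI[of _ "4 * \<tau>"] conjI allI)
    show "r (t + 4 * \<tau>) = r t" for t
      using anti[of "t + 2 * \<tau>"] anti[of t] by (simp add: algebra_simps)
  qed (use turn in simp)
  show "\<phi>1 ` range r = range r"
    by (rule image_range_involution[where k="\<lambda>t. 2 * \<tau> - t"]) (simp_all add: r1)
  show "\<phi>2 ` range r = range r"
    by (rule image_range_involution[where k=uminus]) (simp_all add: r2)
  have up2: "0 < r t $ 2" if "0 < t" "t < 2 * \<tau>" for t
  proof (cases "t \<le> \<tau>")
    case False
    then show ?thesis using up[of "2 * \<tau> - t"] that by (simp add: r1)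
  qed (use up that in auto)
  have spin2: "0 < r 0 $ 1 * cross (r t) (snd (z t))" if "0 \<le> t" "t \<le> 2 * \<tau>" for t
  proof (cases "t \<le> \<tau>")
    case False
    then show ?thesis using spin[of "2 * \<tau> - t"] that by (simp add: r1)
  qed (use spin that in auto)
  have c: "r 0 $ 1 \<noteq> 0" using spin[of 0] turn(1) by auto
  have "cross (r s) (r t) \<noteq> 0" if st: "0 \<le> s" "s < t" "t < 2 * \<tau>" for s t
  proof (cases "s = 0")
    case True
    then show ?thesis using c up2[of t] st start by (simp add: cross_def)
  next
    case False
    \<comment> \<open>The derivative of \<open>x / y\<close> is \<open>- L / y\<^sup>2\<close> with the angular momentum \<open>L\<close>.\<close>
    have "r 0 $ 1 * (r t $ 1 / r t $ 2) < r 0 $ 1 * (r s $ 1 / r s $ 2)"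
    proof (rule DERIV_neg_imp_decreasing[OF \<open>s < t\<close>])
      fix q assume q: "s \<le> q" "q \<le> t"
      then have yq: "0 < r q $ 2" using up2 False st by auto
      have "((\<lambda>t. r 0 $ 1 * (r t $ 1 / r t $ 2)) has_real_derivative
          r 0 $ 1 * ((snd (z q) $ 1 * r q $ 2 - r q $ 1 * snd (z q) $ 2) / (r q $ 2 * r q $ 2))) (at q)"
        using DERIV_cmult[OF DERIV_divide[OF newton_components(1)[OF z, of 1 q] newton_components(1)[OF z, of 2 q]]] yq
        unfolding r_def by simp
      moreover have "r 0 $ 1 * ((snd (z q) $ 1 * r q $ 2 - r q $ 1 * snd (z q) $ 2) / (r q $ 2 * r q $ 2))
          = - (r 0 $ 1 * cross (r q) (snd (z q))) / (r q $ 2 * r q $ 2)"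
        unfolding cross_def by (simp add: algebra_simps)
      moreover have "\<dots> < 0"
      proof (rule divide_neg_pos)
        show "- (r 0 $ 1 * cross (r q) (snd (z q))) < 0"
          using spin2[of q] q st by linarith
      qed (use yq in simp)
      ultimately show "\<exists>y. ((\<lambda>t. r 0 $ 1 * (r t $ 1 / r t $ 2)) has_real_derivative y) (at q) \<and> y < 0"
        by (intro exI conjI) (assumption, simp only:)
    qed
    then have "r t $ 1 / r t $ 2 \<noteq> r s $ 1 / r s $ 2" by (metis order_less_irrefl)
    moreover have "r s $ 2 \<noteq> 0" "r t $ 2 \<noteq> 0" using up2[of s] up2[of t] st False by auto
    ultimately have "r t $ 1 * r s $ 2 \<noteq> r s $ 1 * r t $ 2" by (simp add: frac_eq_eq)
    then show ?thesis unfolding cross_def by (metis eq_iff_diff_eq_0 mult.commute)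
  qed
  moreover have "0 < 2 * \<tau>" using turn(1) by simp
  ultimately show "simple_closed_curve (range r)" "encloses (range r) 0"
    using antiperiodic_curve_around_origin[OF cont _ anti] by blast+
qed

section \<open>The Kepler problem\<close>

text \<open>The first component of the Laplace-Runge-Lenz vector (for unit mass).\<close>

definition runge_lenz :: "real \<Rightarrow> (real^2) \<times> (real^2) \<Rightarrow> real" where
  "runge_lenz \<kappa> z = snd z $ 2 * cross (fst z) (snd z) - \<kappa> * fst z $ 1 / norm (fst z)"

lemma runge_lenz_conserved:
  fixes z :: "real \<Rightarrow> (real^2) \<times> (real^2)"
  assumes z: "\<And>t. (z has_vector_derivative newton f (z t)) (at t)"
    and nz: "\<And>t. t \<in> {0..T} \<Longrightarrow> fst (z t) \<noteq> 0"
    and kepler: "\<And>t. t \<in> {0..T} \<Longrightarrow> f (fst (z t)) = - (\<kappa> / norm (fst (z t)) ^ 3) *\<^sub>R fst (z t)"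
    and "t \<in> {0..T}"
  shows "runge_lenz \<kappa> (z t) = runge_lenz \<kappa> (z 0)"
proof -
  have "((\<lambda>t. runge_lenz \<kappa> (z t)) has_real_derivative 0) (at s within {0..T})" if s: "s \<in> {0..T}" for s
  proof -
    define x y u v where "x t = fst (z t) $ 1" and "y t = fst (z t) $ 2"
      and "u t = snd (z t) $ 1" and "v t = snd (z t) $ 2" for t
    define \<rho> where "\<rho> t = sqrt ((x t)\<^sup>2 + (y t)\<^sup>2)" for t
    have rho: "norm (fst (z t)) = \<rho> t" for t by (simp add: \<rho>_def norm_real2 x_def y_def)
    have rho_pos: "0 < \<rho> s" using nz[OF s] by (metis rho zero_less_norm_iff)
    have rho2: "\<rho> s * \<rho> s = x s * x s + y s * y s"
      by (simp add: \<rho>_def power2_eq_square)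
    have dx: "(x has_real_derivative u s) (at s)" and dy: "(y has_real_derivative v s) (at s)"
      unfolding x_def y_def u_def v_def by (rule newton_components(1)[OF z])+
    have du: "(u has_real_derivative - (\<kappa> / \<rho> s ^ 3) * x s) (at s)"
      and dv: "(v has_real_derivative - (\<kappa> / \<rho> s ^ 3) * y s) (at s)"
      using newton_components(2)[OF z, of 1 s] newton_components(2)[OF z, of 2 s] kepler[OF s]
      unfolding x_def y_def u_def v_def rho[symmetric] by simp_all
    have drho: "(\<rho> has_real_derivative (x s * u s + y s * v s) / \<rho> s) (at s)"
    proof -
      have d: "((\<lambda>t. (x t)\<^sup>2 + (y t)\<^sup>2) has_real_derivative 2 * x s * u s + 2 * y s * v s) (at s)"
        by (auto intro!: derivative_eq_intros dx dy)
      have pos: "0 < (x s)\<^sup>2 + (y s)\<^sup>2"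
        using rho_pos unfolding \<rho>_def by simp
      have "((\<lambda>t. sqrt ((x t)\<^sup>2 + (y t)\<^sup>2)) has_real_derivative
          inverse (sqrt ((x s)\<^sup>2 + (y s)\<^sup>2)) / 2 * (2 * x s * u s + 2 * y s * v s)) (at s)"
        by (rule DERIV_chain2[OF DERIV_real_sqrt[OF pos] d])
      moreover have "inverse (sqrt ((x s)\<^sup>2 + (y s)\<^sup>2)) / 2 * (2 * x s * u s + 2 * y s * v s)
          = (x s * u s + y s * v s) / \<rho> s"
        unfolding \<rho>_def[symmetric] using rho_pos by (simp add: field_simps)
      moreover have "\<rho> = (\<lambda>t. sqrt ((x t)\<^sup>2 + (y t)\<^sup>2))" by (simp add: fun_eq_iff \<rho>_def)
      ultimately show ?thesis by metis
    qed
    have dL: "((\<lambda>t. x t * v t - y t * u t) has_real_derivative 0) (at s)"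
      by (rule DERIV_cong[OF DERIV_diff[OF DERIV_mult[OF dx dv] DERIV_mult[OF dy du]]]) (simp add: algebra_simps)
    have "((\<lambda>t. v t * (x t * v t - y t * u t) - \<kappa> * x t / \<rho> t) has_real_derivative
        - (\<kappa> / \<rho> s ^ 3) * y s * (x s * v s - y s * u s) + 0 * v s
        - (\<kappa> * u s * \<rho> s - \<kappa> * x s * ((x s * u s + y s * v s) / \<rho> s)) / (\<rho> s * \<rho> s)) (at s)"
      by (rule DERIV_cong[OF DERIV_diff[OF DERIV_mult[OF dv dL] DERIV_divide[OF DERIV_cmult[OF dx] drho]]])
        (use rho_pos in simp_all)
    moreover have "- (\<kappa> / \<rho> s ^ 3) * y s * (x s * v s - y s * u s) + 0 * v s
        - (\<kappa> * u s * \<rho> s - \<kappa> * x s * ((x s * u s + y s * v s) / \<rho> s)) / (\<rho> s * \<rho> s)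
        = - (\<kappa> / \<rho> s ^ 3) * (y s * (x s * v s - y s * u s) + u s * (\<rho> s * \<rho> s) - x s * (x s * u s + y s * v s))"
      using rho_pos by (simp add: field_simps power3_eq_cube)
    moreover have "\<dots> = 0" unfolding rho2 by (simp add: algebra_simps)
    ultimately have "((\<lambda>t. v t * (x t * v t - y t * u t) - \<kappa> * x t / \<rho> t) has_real_derivative 0) (at s)"
      by metis
    moreover have "(\<lambda>t. runge_lenz \<kappa> (z t)) = (\<lambda>t. v t * (x t * v t - y t * u t) - \<kappa> * x t / \<rho> t)"
      unfolding runge_lenz_def cross_def rho x_def y_def u_def v_def by (rule refl)
    ultimately show ?thesis by (metis has_field_derivative_at_within)
  qed
  then obtain c where "\<And>t. t \<in> {0..T} \<Longrightarrow> runge_lenz \<kappa> (z t) = c"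
    using has_field_derivative_zero_constant[of "{0..T}" "\<lambda>t. runge_lenz \<kappa> (z t)"] by auto
  then show ?thesis using assms(4) by simp
qed

lemma continuous_on_runge_lenz:
  "continuous_on {z. fst z \<noteq> 0} (runge_lenz \<kappa>)"
  unfolding runge_lenz_def by (auto intro!: continuous_intros)

lemma has_vector_derivative_vector2:
  assumes "(f has_real_derivative f') (at t)" "(g has_real_derivative g') (at t)"
  shows "((\<lambda>t. vector [f t, g t] :: real^2) has_vector_derivative vector [f', g']) (at t)"
proof -
  have split: "vector [a, b] = a *\<^sub>R axis 1 1 + b *\<^sub>R (axis 2 1 :: real^2)" for a b :: real
    by (simp add: vec_eq_iff forall_2 axis_def)
  show ?thesis unfolding split
    by (intro has_vector_derivative_add has_vector_derivative_scaleR[OF assms(1) has_vector_derivative_const, simplified]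
        has_vector_derivative_scaleR[OF assms(2) has_vector_derivative_const, simplified])
qed

text \<open>Starts at \<open>(c, 0)\<close> with velocity \<open>(0, R * \<omega>)\<close>, where \<open>\<bar>c\<bar> = R\<close>; the sign of \<open>c\<close> decides the
  orientation, while the \<open>y\<close>-coordinate increases at first in both cases.\<close>

definition circular_orbit :: "real \<Rightarrow> real \<Rightarrow> real \<Rightarrow> real \<Rightarrow> (real^2) \<times> (real^2)" where
  "circular_orbit c R \<omega> t = (vector [c * cos (\<omega> * t), R * sin (\<omega> * t)],
     vector [- (c * \<omega>) * sin (\<omega> * t), R * \<omega> * cos (\<omega> * t)])"

lemma norm_circular_orbit:
  assumes "\<bar>c\<bar> = R"
  shows "norm (fst (circular_orbit c R \<omega> t)) = R"
    and "norm (snd (circular_orbit c R \<omega> t)) = R * \<bar>\<omega>\<bar>"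
proof -
  have c2: "c\<^sup>2 = R\<^sup>2" using assms by (metis power2_abs)
  have "(c * cos (\<omega> * t))\<^sup>2 + (R * sin (\<omega> * t))\<^sup>2 = R\<^sup>2 * ((sin (\<omega> * t))\<^sup>2 + (cos (\<omega> * t))\<^sup>2)"
    by (simp add: power_mult_distrib c2 algebra_simps del: sin_cos_squared_add sin_cos_squared_add2 sin_cos_squared_add3)
  then show "norm (fst (circular_orbit c R \<omega> t)) = R"
    using assms by (simp add: norm_real2 circular_orbit_def)
  have "(- (c * \<omega>) * sin (\<omega> * t))\<^sup>2 + (R * \<omega> * cos (\<omega> * t))\<^sup>2
      = (R * \<omega>)\<^sup>2 * ((sin (\<omega> * t))\<^sup>2 + (cos (\<omega> * t))\<^sup>2)"
    by (simp add: power_mult_distrib c2 algebra_simps del: sin_cos_squared_add sin_cos_squared_add2 sin_cos_squared_add3)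
  then show "norm (snd (circular_orbit c R \<omega> t)) = R * \<bar>\<omega>\<bar>"
    using assms by (simp add: norm_real2 circular_orbit_def abs_mult)
qed

lemma circular_orbit_solves_kepler:
  assumes "\<bar>c\<bar> = R" "0 < R" "\<kappa> = \<omega>\<^sup>2 * R ^ 3"
    and f: "\<And>p. norm p = R \<Longrightarrow> f p = - (\<kappa> / norm p ^ 3) *\<^sub>R p"
  shows "(circular_orbit c R \<omega> has_vector_derivative newton f (circular_orbit c R \<omega> t)) (at t)"
proof -
  have "f (fst (circular_orbit c R \<omega> t)) = - (\<omega>\<^sup>2) *\<^sub>R fst (circular_orbit c R \<omega> t)"
    using f norm_circular_orbit(1)[OF assms(1)] assms by simp
  then have "newton f (circular_orbit c R \<omega> t) =
      (vector [c * (- sin (\<omega> * t) * \<omega>), R * (cos (\<omega> * t) * \<omega>)],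
       vector [- (c * \<omega>) * (cos (\<omega> * t) * \<omega>), R * \<omega> * (- sin (\<omega> * t) * \<omega>)])"
    by (simp add: newton_def circular_orbit_def vec_eq_iff forall_2 power2_eq_square)
  moreover have "((\<lambda>t. c * cos (\<omega> * t)) has_real_derivative c * (- sin (\<omega> * t) * \<omega>)) (at t)"
    "((\<lambda>t. R * sin (\<omega> * t)) has_real_derivative R * (cos (\<omega> * t) * \<omega>)) (at t)"
    "((\<lambda>t. - (c * \<omega>) * sin (\<omega> * t)) has_real_derivative - (c * \<omega>) * (cos (\<omega> * t) * \<omega>)) (at t)"
    "((\<lambda>t. R * \<omega> * cos (\<omega> * t)) has_real_derivative R * \<omega> * (- sin (\<omega> * t) * \<omega>)) (at t)"
    by (auto intro!: derivative_eq_intros)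
  ultimately show ?thesis
    unfolding circular_orbit_def
    by (simp only:) (intro has_vector_derivative_Pair has_vector_derivative_vector2)
qed

lemma cos_sin_eighth_turn_bounds:
  shows "0 \<le> \<theta> \<Longrightarrow> \<theta> \<le> pi / 4 \<Longrightarrow> 1 / 2 < cos \<theta>"
    and "pi / 4 \<le> \<theta> \<Longrightarrow> \<theta> \<le> 3 * pi / 4 \<Longrightarrow> 1 / 2 < sin \<theta>"
    and "cos (3 * pi / 4) < - 1 / 2"
proof -
  have "1 / 2 < cos (pi / 4)"
  proof -
    have "1 < sqrt 2" by simp
    then show ?thesis unfolding cos_45 by linarith
  qed
  then have *: "1 / 2 < cos \<theta>" if "\<bar>\<theta>\<bar> \<le> pi / 4" for \<theta>
    using cos_monotone_0_pi_le[of "\<bar>\<theta>\<bar>" "pi / 4"] that pi_gt_zero by simp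
  then show "0 \<le> \<theta> \<Longrightarrow> \<theta> \<le> pi / 4 \<Longrightarrow> 1 / 2 < cos \<theta>" by simp
  have "1 / 2 < cos (\<theta> - pi / 2)" if "pi / 4 \<le> \<theta>" "\<theta> \<le> 3 * pi / 4"
    by (rule *) (use that in \<open>auto simp: abs_if\<close>)
  then show "pi / 4 \<le> \<theta> \<Longrightarrow> \<theta> \<le> 3 * pi / 4 \<Longrightarrow> 1 / 2 < sin \<theta>"
    by (simp add: cos_diff)
  have "3 * pi / 4 = pi - pi / 4" by simp
  then have "cos (3 * pi / 4) = - cos (pi / 4)" by (metis cos_pi_minus)
  with \<open>1 / 2 < cos (pi / 4)\<close> show "cos (3 * pi / 4) < - 1 / 2" by linarith
qed

text \<open>What the shooting argument needs to know about a motion that stays close, in position and velocity,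
  to the circular orbit for three eighths of a turn. The coordinate \<open>y\<close> is not bounded away from 0 near
  the start, so its positivity comes from its derivative during the first eighth of the turn.\<close>

lemma nearly_circular_motion:
  fixes z :: "real \<Rightarrow> (real^2) \<times> (real^2)"
  assumes c: "\<bar>c\<bar> = R" and "0 < R" "0 < \<omega>"
    and e: "0 \<le> e" "e < R / 2" "e < R * \<omega> / 2" "e \<le> 1" "2 * e * (R * \<omega> + 1 + R) < R\<^sup>2 * \<omega>"
    and der: "\<And>t. ((\<lambda>t. fst (z t)) has_vector_derivative snd (z t)) (at t)"
    and start: "fst (z 0) $ 2 = 0"
    and close: "\<And>t. 0 \<le> t \<Longrightarrow> \<omega> * t \<le> 3 * pi / 4 \<Longrightarrow> norm (z t - circular_orbit c R \<omega> t) \<le> e"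
  shows "\<And>t. 0 \<le> t \<Longrightarrow> \<omega> * t \<le> 3 * pi / 4 \<Longrightarrow> \<bar>norm (fst (z t)) - R\<bar> \<le> e"
    and "\<And>t. 0 \<le> t \<Longrightarrow> \<omega> * t \<le> 3 * pi / 4 \<Longrightarrow> norm (snd (z t)) \<le> R * \<omega> + 1"
    and "\<And>t. 0 \<le> t \<Longrightarrow> \<omega> * t \<le> 3 * pi / 4 \<Longrightarrow> 0 < c * cross (fst (z t)) (snd (z t))"
    and "\<And>t. 0 < t \<Longrightarrow> \<omega> * t \<le> 3 * pi / 4 \<Longrightarrow> 0 < fst (z t) $ 2"
    and "\<And>t. \<omega> * t = pi / 4 \<Longrightarrow> 0 < c * fst (z t) $ 1"
    and "\<And>t. \<omega> * t = 3 * pi / 4 \<Longrightarrow> c * fst (z t) $ 1 < 0"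
proof -
  define p q where "p t = fst (z t)" and "q t = snd (z t)" for t
  define p0 q0 where "p0 t = fst (circular_orbit c R \<omega> t)" and "q0 t = snd (circular_orbit c R \<omega> t)" for t
  have cc: "c * c = R * R" using c by (metis abs_mult_self_eq)
  have np0: "norm (p0 t) = R" and nq0: "norm (q0 t) = R * \<omega>" for t
    using norm_circular_orbit[OF c, of \<omega> t] \<open>0 < \<omega>\<close> by (simp_all add: p0_def q0_def)
  have dist: "norm (p t - p0 t) \<le> e" "norm (q t - q0 t) \<le> e" if "0 \<le> t" "\<omega> * t \<le> 3 * pi / 4" for t
    using close[OF that] norm_fst_le[of "p t - p0 t" "q t - q0 t"] norm_snd_le[of "q t - q0 t" "p t - p0 t"]
    by (simp_all add: minus_prod_def p_def q_def p0_def q0_def)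
  have comp: "\<bar>p t $ i - p0 t $ i\<bar> \<le> e" "\<bar>q t $ i - q0 t $ i\<bar> \<le> e" if "0 \<le> t" "\<omega> * t \<le> 3 * pi / 4" for t i
    using dist[OF that] component_le_norm_cart[of "p t - p0 t" i] component_le_norm_cart[of "q t - q0 t" i] by auto
  show "\<bar>norm (fst (z t)) - R\<bar> \<le> e" if "0 \<le> t" "\<omega> * t \<le> 3 * pi / 4" for t
    using dist(1)[OF that] norm_triangle_ineq3[of "p t" "p0 t"] by (simp add: np0 p_def)
  show nq: "norm (snd (z t)) \<le> R * \<omega> + 1" if "0 \<le> t" "\<omega> * t \<le> 3 * pi / 4" for t
    using dist(2)[OF that] norm_triangle_sub[of "q t" "q0 t"] nq0[of t] e(4) unfolding q_def by linarith
  show "0 < c * cross (fst (z t)) (snd (z t))" if t: "0 \<le> t" "\<omega> * t \<le> 3 * pi / 4" for t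
  proof -
    have "cross (p0 t) (q0 t) = c * (R * \<omega>) * ((sin (\<omega> * t))\<^sup>2 + (cos (\<omega> * t))\<^sup>2)"
      unfolding p0_def q0_def circular_orbit_def cross_def
      by (simp add: power2_eq_square algebra_simps del: sin_cos_squared_add sin_cos_squared_add2 sin_cos_squared_add3)
    then have "c * cross (p0 t) (q0 t) = c * c * (R * \<omega>)" by simp
    then have circ: "c * cross (p0 t) (q0 t) = R * (R\<^sup>2 * \<omega>)" by (simp add: cc power2_eq_square)
    have "cross (p t) (q t) - cross (p0 t) (q0 t) = cross (p t - p0 t) (q t) + cross (p0 t) (q t - q0 t)"
      by (simp add: cross_def algebra_simps)
    moreover have "\<bar>cross (p t - p0 t) (q t)\<bar> \<le> 2 * (e * (R * \<omega> + 1))"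
      using abs_cross_le[of "p t - p0 t" "q t"] mult_mono[OF dist(1)[OF t] nq[OF t]] e(1)
      by (simp add: q_def)
    moreover have "\<bar>cross (p0 t) (q t - q0 t)\<bar> \<le> 2 * (R * e)"
    proof -
      have "R * norm (q t - q0 t) \<le> R * e" using dist(2)[OF t] \<open>0 < R\<close> by (intro mult_left_mono) auto
      then show ?thesis using abs_cross_le[of "p0 t" "q t - q0 t"] unfolding np0 by linarith
    qed
    ultimately have "\<bar>cross (p t) (q t) - cross (p0 t) (q0 t)\<bar> \<le> 2 * e * (R * \<omega> + 1 + R)"
      by (simp add: algebra_simps)
    then have "\<bar>cross (p t) (q t) - cross (p0 t) (q0 t)\<bar> < R\<^sup>2 * \<omega>" using e(5) by linarith
    then have "\<bar>c * (cross (p t) (q t) - cross (p0 t) (q0 t))\<bar> < R * (R\<^sup>2 * \<omega>)"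
      unfolding abs_mult c using \<open>0 < R\<close> by (rule mult_strict_left_mono)
    then have "0 < c * cross (p t) (q t)"
      unfolding right_diff_distrib circ by linarith
    then show ?thesis by (simp add: p_def q_def)
  qed
  have y0: "p0 t $ 2 = R * sin (\<omega> * t)" and v0: "q0 t $ 2 = R * \<omega> * cos (\<omega> * t)"
    and x0: "p0 t $ 1 = c * cos (\<omega> * t)" for t
    by (simp_all add: p0_def q0_def circular_orbit_def)
  show "0 < fst (z t) $ 2" if t: "0 < t" "\<omega> * t \<le> 3 * pi / 4" for t
  proof (cases "\<omega> * t \<le> pi / 4")
    case True
    have "p 0 $ 2 < p t $ 2"
    proof (rule DERIV_pos_imp_increasing[OF t(1)])
      fix s assume s: "0 \<le> s" "s \<le> t"
      then have "\<omega> * s \<le> \<omega> * t" "0 \<le> \<omega> * s" using \<open>0 < \<omega>\<close> by simp_all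
      then have s': "0 \<le> \<omega> * s" "\<omega> * s \<le> pi / 4" "\<omega> * s \<le> 3 * pi / 4" using True t(2) by linarith+
      have "R * \<omega> * (1 / 2) < R * \<omega> * cos (\<omega> * s)"
        using cos_sin_eighth_turn_bounds(1)[OF s'(1,2)] \<open>0 < R\<close> \<open>0 < \<omega>\<close> by (intro mult_strict_left_mono) auto
      then have "0 < q s $ 2" using comp(2)[OF s(1) s'(3), of 2] e(3) v0[of s] by linarith
      moreover have "((\<lambda>t. p t $ 2) has_real_derivative q s $ 2) (at s)"
        using bounded_linear.has_vector_derivative[OF bounded_linear_vec_nth der, of 2 s]
        by (simp add: has_real_derivative_iff_has_vector_derivative p_def q_def)
      ultimately show "\<exists>y. ((\<lambda>t. p t $ 2) has_real_derivative y) (at s) \<and> 0 < y" by blast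
    qed
    then show ?thesis using start by (simp add: p_def)
  next
    case False
    have "R * (1 / 2) < R * sin (\<omega> * t)"
      using cos_sin_eighth_turn_bounds(2)[of "\<omega> * t"] False t(2) \<open>0 < R\<close> by (intro mult_strict_left_mono) auto
    then have "0 < p t $ 2" using comp(1)[of t 2] t e(2) y0[of t] by linarith
    then show ?thesis by (simp add: p_def)
  qed
  have x_near: "\<bar>c * p t $ 1 - R * R * cos (\<omega> * t)\<bar> \<le> R * e" if "0 \<le> t" "\<omega> * t \<le> 3 * pi / 4" for t
  proof -
    have "c * p t $ 1 - R * R * cos (\<omega> * t) = c * (p t $ 1 - p0 t $ 1)"
      by (simp add: x0 right_diff_distrib cc flip: mult.assoc)
    then show ?thesis
      using mult_left_mono[OF comp(1)[OF that, of 1], of R] \<open>0 < R\<close> by (simp add: abs_mult c)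
  qed
  have Re: "R * e < R * R * (1 / 2)" using e(2) \<open>0 < R\<close> by simp
  show "0 < c * fst (z t) $ 1" if t: "\<omega> * t = pi / 4" for t
  proof -
    have "0 < \<omega> * t" using pi_gt_zero unfolding t by simp
    then have t0: "0 \<le> t" using \<open>0 < \<omega>\<close> by (simp add: zero_less_mult_iff)
    have "1 / 2 < cos (\<omega> * t)" unfolding t by (rule cos_sin_eighth_turn_bounds(1)) simp_all
    then have "R * R * (1 / 2) < R * R * cos (\<omega> * t)" using \<open>0 < R\<close> by (intro mult_strict_left_mono) auto
    then show ?thesis using x_near[OF t0] Re t pi_gt_zero unfolding p_def by linarith
  qed
  show "c * fst (z t) $ 1 < 0" if t: "\<omega> * t = 3 * pi / 4" for t
  proof -
    have "0 < \<omega> * t" using pi_gt_zero unfolding t by simp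
    then have t0: "0 \<le> t" using \<open>0 < \<omega>\<close> by (simp add: zero_less_mult_iff)
    have "cos (\<omega> * t) < - 1 / 2" unfolding t by (rule cos_sin_eighth_turn_bounds(3))
    then have "R * R * cos (\<omega> * t) < R * R * (- 1 / 2)"
      using \<open>0 < R\<close> by (intro mult_strict_left_mono) auto
    then show ?thesis using x_near[OF t0] Re t unfolding p_def by linarith
  qed
qed

section \<open>Extending the force from an annulus to the plane\<close>

lemma C1_on_imp_lipschitz_on_compact:
  fixes f :: "'a::{banach,heine_borel} \<Rightarrow> 'a"
  assumes "C1_on f U" "open U" "compact K" "K \<subseteq> U"
  obtains M where "M-lipschitz_on K f"
proof -
  obtain f' :: "'a \<Rightarrow> 'a \<Rightarrow>\<^sub>L 'a" where f': "\<And>x. x \<in> U \<Longrightarrow> (f has_derivative blinfun_apply (f' x)) (at x)"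
    and contf': "continuous_on U f'" using assms(1) unfolding C1_on_def by blast
  have "local_lipschitz (UNIV::real set) U (\<lambda>_. f)"
  proof (rule c1_implies_local_lipschitz[where f'="\<lambda>p. f' (snd p)"])
    show "continuous_on (UNIV \<times> U) (\<lambda>p. f' (snd p))"
      by (rule continuous_on_compose2[OF contf' continuous_on_snd]) (auto intro: continuous_on_id)
  qed (use f' assms(2) in auto)
  then have "local_lipschitz {0::real} K (\<lambda>_. f)"
    by (rule local_lipschitz_subset) (use assms(4) in auto)
  from local_lipschitz_compact_implies_lipschitz[OF this assms(3)] obtain M where "M-lipschitz_on K f"
    by auto
  then show thesis by (rule that)
qed

text \<open>If only one of two points lies in \<open>K\<close>, the value of the cutoff \<open>\<zeta>\<close> at the other is 0, and the
  Lipschitz constant of \<open>\<zeta>\<close> alone controls the difference.\<close>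

lemma lipschitz_on_cutoff:
  fixes f :: "'a::metric_space \<Rightarrow> 'b::real_normed_vector"
  assumes f: "M-lipschitz_on K f" and B: "\<And>p. p \<in> K \<Longrightarrow> norm (f p) \<le> B" "0 \<le> B"
    and ch: "N-lipschitz_on UNIV \<zeta>" and ch1: "\<And>p. \<bar>\<zeta> p\<bar> \<le> (1::real)"
    and off: "\<And>p. p \<notin> K \<Longrightarrow> \<zeta> p = 0"
  shows "(M + N * B)-lipschitz_on UNIV (\<lambda>p. \<zeta> p *\<^sub>R f p)"
proof (rule lipschitz_onI)
  have M: "0 \<le> M" and N: "0 \<le> N" using f ch lipschitz_on_nonneg by blast+
  then show "0 \<le> M + N * B" using B by simp
  have one: "dist (\<zeta> p *\<^sub>R f p) (\<zeta> q *\<^sub>R f q) \<le> (M + N * B) * dist p q" if "p \<in> K" for p q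
  proof -
    have "(\<zeta> p - \<zeta> q) *\<^sub>R f p + \<zeta> q *\<^sub>R (f p - f q) = \<zeta> p *\<^sub>R f p - \<zeta> q *\<^sub>R f q"
      by (simp add: algebra_simps)
    then have "dist (\<zeta> p *\<^sub>R f p) (\<zeta> q *\<^sub>R f q) \<le> \<bar>\<zeta> p - \<zeta> q\<bar> * norm (f p) + \<bar>\<zeta> q\<bar> * norm (f p - f q)"
      unfolding dist_norm by (metis norm_scaleR norm_triangle_ineq)
    also have "\<bar>\<zeta> p - \<zeta> q\<bar> * norm (f p) \<le> (N * dist p q) * B"
      using lipschitz_onD[OF ch, of p q] B that N
      by (intro mult_mono) (auto simp: dist_real_def)
    also have "\<bar>\<zeta> q\<bar> * norm (f p - f q) \<le> M * dist p q"
    proof (cases "q \<in> K")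
      case True
      then have "norm (f p - f q) \<le> M * dist p q"
        using lipschitz_onD[OF f that True] by (simp add: dist_norm)
      then have "\<bar>\<zeta> q\<bar> * norm (f p - f q) \<le> 1 * (M * dist p q)"
        by (intro mult_mono ch1) auto
      then show ?thesis by simp
    qed (use off M in auto)
    finally show ?thesis by (simp add: algebra_simps)
  qed
  fix p q
  show "dist (\<zeta> p *\<^sub>R f p) (\<zeta> q *\<^sub>R f q) \<le> (M + N * B) * dist p q"
  proof (cases "p \<in> K \<or> q \<in> K")
    case True
    then show ?thesis using one[of p q] one[of q p] by (auto simp: dist_commute)
  next
    case False
    then show ?thesis using off M N B by simp
  qed
qed

lemma annulus_in_neighbourhood_of_circle:
  fixes U :: "'a::euclidean_space set"
  assumes "open U" "sphere 0 R \<subseteq> U" "0 < R"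
  obtains d where "0 < d" "2 * d < R" "\<And>p. \<bar>norm p - R\<bar> \<le> 2 * d \<Longrightarrow> p \<in> U"
proof -
  obtain e where e: "e > 0" "(\<Union>x\<in>sphere 0 R. ball x e) \<subseteq> U"
    using compact_subset_open_imp_ball_epsilon_subset[OF compact_sphere assms(1,2)] by metis
  define d where "d = min (e/4) (R/4)"
  have d: "0 < d" "2 * d < R" "2 * d < e" using e assms(3) by (auto simp: d_def min_def)
  have "p \<in> U" if p: "\<bar>norm p - R\<bar> \<le> 2 * d" for p
  proof -
    have "norm p > 0" using p d by auto
    then have "norm (p - (R / norm p) *\<^sub>R p) = \<bar>norm p - R\<bar>"
    proof -
      have "p - (R / norm p) *\<^sub>R p = (1 - R / norm p) *\<^sub>R p" by (simp add: algebra_simps)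
      then have "norm (p - (R / norm p) *\<^sub>R p) = \<bar>1 - R / norm p\<bar> * norm p" by simp
      also have "\<dots> = \<bar>(1 - R / norm p) * norm p\<bar>" by (simp add: abs_mult)
      also have "(1 - R / norm p) * norm p = norm p - R" using \<open>norm p > 0\<close> by (simp add: field_simps)
      finally show ?thesis .
    qed
    then have "p \<in> ball ((R / norm p) *\<^sub>R p) e"
      using p d by (simp add: dist_norm norm_minus_commute)
    moreover have "(R / norm p) *\<^sub>R p \<in> sphere 0 R"
      using \<open>norm p > 0\<close> assms(3) by simp
    ultimately show ?thesis using e(2) by blast
  qed
  then show thesis using that d by blast
qed

text \<open>The cutoff depends on the distance to the origin only and so preserves the symmetries. The Lipschitz
  constants may depend on \<open>\<mu>\<close>; uniform closeness as \<open>\<mu>\<close> tends to 0 follows from uniform continuity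
  on a compact set.\<close>

lemma annular_extension_of_family:
  fixes g :: "real^2 \<Rightarrow> real \<Rightarrow> real^2"
  assumes "0 < a" "0 < d" and U: "open U" "\<And>p. \<bar>norm p - R\<bar> \<le> 2 * d \<Longrightarrow> p \<in> U"
    and contg: "continuous_on (U \<times> {-a<..<a}) (\<lambda>(p, \<mu>). g p \<mu>)"
    and C1: "\<And>\<mu>. \<bar>\<mu>\<bar> < a \<Longrightarrow> C1_on (\<lambda>p. g p \<mu>) U"
    and sym: "\<And>\<mu> p. \<bar>\<mu>\<bar> < a \<Longrightarrow> p \<in> U \<Longrightarrow> g (\<phi>1 p) \<mu> = \<phi>1 (g p \<mu>) \<and> g (\<phi>2 p) \<mu> = \<phi>2 (g p \<mu>)"
  obtains h where "\<And>\<mu> p. \<bar>norm p - R\<bar> \<le> d \<Longrightarrow> h \<mu> p = g p \<mu>"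
    "\<And>\<mu>. \<bar>\<mu>\<bar> < a \<Longrightarrow> \<exists>M. M-lipschitz_on UNIV (h \<mu>)"
    "\<And>\<mu> p. \<bar>\<mu>\<bar> < a \<Longrightarrow> h \<mu> (\<phi>1 p) = \<phi>1 (h \<mu> p) \<and> h \<mu> (\<phi>2 p) = \<phi>2 (h \<mu> p)"
    "\<And>\<epsilon>. 0 < \<epsilon> \<Longrightarrow> \<exists>\<delta>. 0 < \<delta> \<and> \<delta> < a \<and> (\<forall>\<mu>. \<bar>\<mu>\<bar> < \<delta> \<longrightarrow> (\<forall>p. norm (h \<mu> p - h 0 p) \<le> \<epsilon>))"
proof -
  define K where "K = {p :: real^2. \<bar>norm p - R\<bar> \<le> 2 * d}"
  have KU: "K \<subseteq> U" using U(2) by (auto simp: K_def)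
  have "K \<subseteq> cball 0 (R + 2 * d)" by (auto simp: K_def)
  then have "bounded K" using bounded_cball bounded_subset by blast
  moreover have "closed K" unfolding K_def by (intro closed_Collect_le continuous_intros)
  ultimately have "compact K" by (simp add: compact_eq_bounded_closed)
  define \<zeta> where "\<zeta> p = max 0 (min 1 (2 - \<bar>norm p - R\<bar> / d))" for p :: "real^2"
  have ch_bound: "0 \<le> \<zeta> p" "\<zeta> p \<le> 1" for p by (auto simp: \<zeta>_def)
  have ch_lip: "(1 / d)-lipschitz_on UNIV \<zeta>"
  proof (rule lipschitz_onI)
    fix p q
    have "\<bar>\<zeta> p - \<zeta> q\<bar> \<le> \<bar>(2 - \<bar>norm p - R\<bar> / d) - (2 - \<bar>norm q - R\<bar> / d)\<bar>"
    proof -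
      have clamp: "\<bar>max 0 (min 1 u) - max 0 (min 1 v)\<bar> \<le> \<bar>u - v\<bar>" for u v :: real
        by (auto simp: max_def min_def)
      show ?thesis unfolding \<zeta>_def by (rule clamp)
    qed
    also have "\<dots> = \<bar>\<bar>norm q - R\<bar> - \<bar>norm p - R\<bar>\<bar> / d"
      using \<open>0 < d\<close> by (simp add: diff_divide_distrib[symmetric])
    also have "\<dots> \<le> norm (p - q) / d"
      using \<open>0 < d\<close> norm_triangle_ineq3[of p q] by (intro divide_right_mono) linarith+
    finally show "dist (\<zeta> p) (\<zeta> q) \<le> 1 / d * dist p q" by (simp add: dist_norm dist_real_def)
  qed (use \<open>0 < d\<close> in simp)
  have ch_off: "\<zeta> p = 0" if "p \<notin> K" for p
    using that \<open>0 < d\<close> unfolding K_def \<zeta>_def by (simp add: max_def min_def field_simps)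
  have ch_on: "\<zeta> p = 1" if "\<bar>norm p - R\<bar> \<le> d" for p
    using that \<open>0 < d\<close> unfolding \<zeta>_def by (simp add: max_def min_def field_simps)
  have ch_sym: "\<zeta> (\<phi>1 p) = \<zeta> p" "\<zeta> (\<phi>2 p) = \<zeta> p" for p by (simp_all add: \<zeta>_def)
  have K_sym: "\<phi>1 p \<in> K \<longleftrightarrow> p \<in> K" "\<phi>2 p \<in> K \<longleftrightarrow> p \<in> K" for p by (simp_all add: K_def)
  define h where "h \<mu> p = \<zeta> p *\<^sub>R g p \<mu>" for \<mu> p
  show thesis
  proof (rule that)
    show "h \<mu> p = g p \<mu>" if "\<bar>norm p - R\<bar> \<le> d" for \<mu> p
      by (simp add: h_def ch_on[OF that])
  next
    fix \<mu> assume mu: "\<bar>\<mu>\<bar> < a"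
    obtain M where M: "M-lipschitz_on K (\<lambda>p. g p \<mu>)"
      using C1_on_imp_lipschitz_on_compact[OF C1[OF mu] U(1) \<open>compact K\<close> KU] .
    have "bounded ((\<lambda>p. g p \<mu>) ` K)"
      using \<open>compact K\<close> lipschitz_on_continuous_on[OF M] by (simp add: compact_continuous_image compact_imp_bounded)
    then obtain B where B: "0 < B" "\<And>p. p \<in> K \<Longrightarrow> norm (g p \<mu>) \<le> B"
      unfolding bounded_pos by blast
    show "\<exists>M. M-lipschitz_on UNIV (h \<mu>)"
      unfolding h_def
      by (rule exI, rule lipschitz_on_cutoff[OF M _ _ ch_lip]) (use B ch_bound ch_off in auto)
  next
    fix \<mu> p assume mu: "\<bar>\<mu>\<bar> < a"
    show "h \<mu> (\<phi>1 p) = \<phi>1 (h \<mu> p) \<and> h \<mu> (\<phi>2 p) = \<phi>2 (h \<mu> p)"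
    proof (cases "p \<in> K")
      case True
      then have "g (\<phi>1 p) \<mu> = \<phi>1 (g p \<mu>)" "g (\<phi>2 p) \<mu> = \<phi>2 (g p \<mu>)" using sym[OF mu] KU by auto
      then show ?thesis by (simp add: h_def ch_sym vec_eq_iff forall_2)
    next
      case False
      then show ?thesis by (simp add: h_def ch_off K_sym vec_eq_iff forall_2)
    qed
  next
    fix \<epsilon> :: real assume "0 < \<epsilon>"
    have "continuous_on (K \<times> {-a/2..a/2}) (\<lambda>(p, \<mu>). g p \<mu>)"
      by (rule continuous_on_subset[OF contg]) (use KU \<open>0 < a\<close> in auto)
    then have "uniformly_continuous_on (K \<times> {-a/2..a/2}) (\<lambda>(p, \<mu>). g p \<mu>)"
      by (intro compact_uniformly_continuous compact_Times \<open>compact K\<close>) auto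
    then obtain \<delta> where \<delta>: "0 < \<delta>"
      "\<And>z z'. z \<in> K \<times> {-a/2..a/2} \<Longrightarrow> z' \<in> K \<times> {-a/2..a/2} \<Longrightarrow> dist z' z < \<delta> \<Longrightarrow>
          dist (case z' of (p, \<mu>) \<Rightarrow> g p \<mu>) (case z of (p, \<mu>) \<Rightarrow> g p \<mu>) < \<epsilon>"
      using \<open>0 < \<epsilon>\<close> unfolding uniformly_continuous_on_def by metis
    show "\<exists>\<delta>. 0 < \<delta> \<and> \<delta> < a \<and> (\<forall>\<mu>. \<bar>\<mu>\<bar> < \<delta> \<longrightarrow> (\<forall>p. norm (h \<mu> p - h 0 p) \<le> \<epsilon>))"
    proof (intro exI[of _ "min \<delta> (a/2)"] conjI allI impI)
      fix \<mu> p assume mu: "\<bar>\<mu>\<bar> < min \<delta> (a/2)"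
      show "norm (h \<mu> p - h 0 p) \<le> \<epsilon>"
      proof (cases "p \<in> K")
        case True
        have "norm (g p \<mu> - g p 0) < \<epsilon>"
        proof -
          have "\<mu> \<in> {-a/2..a/2}" "0 \<in> {-a/2..a/2}" using mu \<open>0 < a\<close> by auto
          then show ?thesis
            using \<delta>(2)[of "(p, 0)" "(p, \<mu>)"] True mu by (simp add: dist_Pair_Pair dist_norm)
        qed
        then have "\<zeta> p * norm (g p \<mu> - g p 0) \<le> 1 * \<epsilon>"
          using ch_bound[of p] \<open>0 < \<epsilon>\<close> by (intro mult_mono) auto
        moreover have "norm (h \<mu> p - h 0 p) = \<zeta> p * norm (g p \<mu> - g p 0)"
          using ch_bound[of p] by (simp add: h_def flip: scaleR_diff_right)
        ultimately show ?thesis by simp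
      next
        case False
        then show ?thesis using \<open>0 < \<epsilon>\<close> by (simp add: h_def ch_off)
      qed
    qed (use \<delta> \<open>0 < a\<close> in auto)
  qed
qed

section \<open>Shooting from the x-axis to the y-axis\<close>

text \<open>The unknowns are the time \<open>t\<close>, in an interval around the quarter period of the circular orbit, and
  the initial speed \<open>w\<close>, in \<open>[w0 - \<epsilon>, w0 + \<epsilon>]\<close>. All motions concerned stay so close to the circular
  one that the first coordinate changes sign in this time interval. On the sides \<open>w = w0 \<plusminus> \<epsilon>\<close> the
  conserved value \<open>R\<^sup>2 * (w\<^sup>2 - w0\<^sup>2)\<close> of \<open>c * runge_lenz \<kappa>\<close> in the Kepler problem dominates the
  perturbation. At a common zero the velocity is perpendicular to the \<open>y\<close>-axis because the angular
  momentum does not vanish.\<close>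

lemma shooting_from_axis_to_axis:
  fixes h :: "real \<Rightarrow> real^2 \<Rightarrow> real^2"
  assumes R: "0 < R" "0 < d" "d < R" and "0 < \<kappa>" and c: "\<bar>c\<bar> = R" and "0 < a"
    and lip: "\<And>\<mu>. \<bar>\<mu>\<bar> < a \<Longrightarrow> \<exists>M. M-lipschitz_on UNIV (h \<mu>)"
    and kepler: "\<And>p. \<bar>norm p - R\<bar> \<le> d \<Longrightarrow> h 0 p = - (\<kappa> / norm p ^ 3) *\<^sub>R p"
    and near: "\<And>\<epsilon>. 0 < \<epsilon> \<Longrightarrow> \<exists>\<delta>. 0 < \<delta> \<and> \<delta> < a \<and> (\<forall>\<mu>. \<bar>\<mu>\<bar> < \<delta> \<longrightarrow> (\<forall>p. norm (h \<mu> p - h 0 p) \<le> \<epsilon>))"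
    and "0 < \<eta>"
  obtains \<delta> where "0 < \<delta>" "\<delta> < a"
    "\<And>\<mu>. \<bar>\<mu>\<bar> < \<delta> \<Longrightarrow> \<exists>w z \<tau>. \<bar>w - sqrt (\<kappa> / R)\<bar> \<le> \<eta> \<and> z 0 = (vector [c, 0], vector [0, w]) \<and>
        (\<forall>t. (z has_vector_derivative newton (h \<mu>) (z t)) (at t)) \<and>
        0 < \<tau> \<and> fst (z \<tau>) $ 1 = 0 \<and> snd (z \<tau>) $ 2 = 0 \<and>
        (\<forall>t. 0 \<le> t \<longrightarrow> t \<le> \<tau> \<longrightarrow> \<bar>norm (fst (z t)) - R\<bar> \<le> d \<and> 0 < c * cross (fst (z t)) (snd (z t))) \<and>
        (\<forall>t. 0 < t \<longrightarrow> t \<le> \<tau> \<longrightarrow> 0 < fst (z t) $ 2)"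
proof -
  define w0 \<omega> where "w0 = sqrt (\<kappa> / R)" and "\<omega> = w0 / R"
  have w0: "0 < w0" "w0\<^sup>2 = \<kappa> / R" using R(1) \<open>0 < \<kappa>\<close> by (simp_all add: w0_def)
  have \<omega>: "0 < \<omega>" "R * \<omega> = w0" using w0 R(1) by (simp_all add: \<omega>_def)
  have \<kappa>: "\<kappa> = \<omega>\<^sup>2 * R ^ 3"
    using w0(2) R(1) by (simp add: \<omega>_def power_divide field_simps power2_eq_square power3_eq_cube)
  define T where "T = 3 * pi / (4 * \<omega>)"
  have T: "0 < T" using \<omega> by (simp add: T_def)
  have T_iff: "\<omega> * t \<le> 3 * pi / 4 \<longleftrightarrow> t \<le> T" for t using \<omega>(1) by (simp add: T_def field_simps)
  obtain M where M: "M-lipschitz_on UNIV (h 0)" using lip[of 0] \<open>0 < a\<close> by auto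
  define K where "K = 2 * exp (2 * (M + 1) * T)"
  have K: "0 < K" by (simp add: K_def)
  \<comment> \<open>The tolerance for \<open>nearly_circular_motion\<close>, and small enough to stay in the annulus.\<close>
  define e where "e = Min {d, R / 4, R * \<omega> / 4, 1, R\<^sup>2 * \<omega> / (4 * (R * \<omega> + 1 + R))}"
  have pos: "0 < R * \<omega>" "0 < R\<^sup>2 * \<omega>" "0 < R * \<omega> + 1 + R" using R(1) \<omega> w0(1) by simp_all
  have "0 < e" unfolding e_def using R pos by (subst Min_gr_iff) auto
  have e_le: "e \<le> d" "e \<le> R / 4" "e \<le> R * \<omega> / 4" "e \<le> 1" "e \<le> R\<^sup>2 * \<omega> / (4 * (R * \<omega> + 1 + R))"
    unfolding e_def by (intro Min_le; simp)+
  have "4 * e * (R * \<omega> + 1 + R) \<le> R\<^sup>2 * \<omega>"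
    using e_le(5) pos(3) by (simp add: field_simps)
  then have e: "0 \<le> e" "e < R / 2" "e < R * \<omega> / 2" "e \<le> 1" "2 * e * (R * \<omega> + 1 + R) < R\<^sup>2 * \<omega>"
    using e_le \<open>0 < e\<close> R(1) pos by (simp_all; linarith)+
  \<comment> \<open>The deviation of the initial speed may use up one half of the tolerance \<open>e\<close>, the perturbation of the force the other half.\<close>
  define \<epsilon> where "\<epsilon> = Min {\<eta>, w0 / 2, e / (2 * K)}"
  have "0 < \<epsilon>" unfolding \<epsilon>_def using \<open>0 < \<eta>\<close> w0 \<open>0 < e\<close> K by (subst Min_gr_iff) auto
  have \<epsilon>_le: "\<epsilon> \<le> \<eta>" "\<epsilon> \<le> w0 / 2" "\<epsilon> \<le> e / (2 * K)" unfolding \<epsilon>_def by (intro Min_le; simp)+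
  \<comment> \<open>A compact set of states on which the Runge-Lenz component is uniformly continuous.\<close>
  define S where "S = {p :: real^2. \<bar>norm p - R\<bar> \<le> d} \<times> cball (0 :: real^2) (R * \<omega> + 1)"
  have "{p :: real^2. \<bar>norm p - R\<bar> \<le> d} \<subseteq> cball 0 (R + d)" by auto
  then have "bounded {p :: real^2. \<bar>norm p - R\<bar> \<le> d}" using bounded_cball bounded_subset by blast
  moreover have "closed {p :: real^2. \<bar>norm p - R\<bar> \<le> d}" by (intro closed_Collect_le continuous_intros)
  ultimately have "compact S" unfolding S_def by (simp add: compact_eq_bounded_closed compact_Times bounded_Times closed_Times)
  have S_nz: "fst z \<noteq> 0" if "z \<in> S" for z using that R by (auto simp: S_def)
  have contE: "continuous_on S (\<lambda>z. c * runge_lenz \<kappa> z)"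
    by (intro continuous_intros continuous_on_subset[OF continuous_on_runge_lenz]) (use S_nz in auto)
  \<comment> \<open>A lower bound for \<open>R\<^sup>2 * \<bar>w\<^sup>2 - w0\<^sup>2\<bar>\<close> at the two extreme speeds; for the lower one because \<open>\<epsilon> \<le> w0\<close>.\<close>
  define m where "m = R\<^sup>2 * (\<epsilon> * w0)"
  have "0 < m" using R \<open>0 < \<epsilon>\<close> w0 by (simp add: m_def)
  obtain \<gamma> where \<gamma>: "0 < \<gamma>" "\<And>z z'. z \<in> S \<Longrightarrow> z' \<in> S \<Longrightarrow> dist z' z < \<gamma> \<Longrightarrow>
      \<bar>c * runge_lenz \<kappa> z' - c * runge_lenz \<kappa> z\<bar> < m"
    using compact_uniformly_continuous[OF contE \<open>compact S\<close>] \<open>0 < m\<close>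
    unfolding uniformly_continuous_on_def dist_real_def by metis
  define \<epsilon>' where "\<epsilon>' = min (e / (2 * K * T)) (\<gamma> / (2 * K * T))"
  have "0 < \<epsilon>'" using \<open>0 < e\<close> \<gamma>(1) K T by (simp add: \<epsilon>'_def)
  have "K * (\<epsilon>' * T) \<le> e / 2" "K * (\<epsilon>' * T) < \<gamma>"
  proof -
    have "\<epsilon>' \<le> e / (2 * K * T)" "\<epsilon>' \<le> \<gamma> / (2 * K * T)" by (simp_all add: \<epsilon>'_def)
    then have "\<epsilon>' * (2 * K * T) \<le> e" "\<epsilon>' * (2 * K * T) \<le> \<gamma>"
      using K T by (simp_all add: pos_le_divide_eq)
    then show "K * (\<epsilon>' * T) \<le> e / 2" "K * (\<epsilon>' * T) < \<gamma>" using \<gamma>(1) by (simp_all add: ac_simps)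
  qed
  have "K * \<epsilon> \<le> e / 2" using \<epsilon>_le(3) K by (simp add: field_simps)
  obtain \<delta> where \<delta>: "0 < \<delta>" "\<delta> < a" "\<And>\<mu> p. \<bar>\<mu>\<bar> < \<delta> \<Longrightarrow> norm (h \<mu> p - h 0 p) \<le> \<epsilon>'"
    using near[OF \<open>0 < \<epsilon>'\<close>] by metis
  have circ: "(circular_orbit c R \<omega> has_vector_derivative newton (h 0) (circular_orbit c R \<omega> t)) (at t)" for t
    by (rule circular_orbit_solves_kepler[OF c R(1) \<kappa>]) (use kepler R in auto)
  have circ0: "circular_orbit c R \<omega> 0 = (vector [c, 0], vector [0, w0])"
    by (simp add: circular_orbit_def \<omega>)
  have init_diff: "norm ((vector [c, 0], vector [0, w]) - ((vector [c, 0], vector [0, w']) :: (real^2) \<times> (real^2))) = \<bar>w - w'\<bar>" for w w'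
    by (simp add: minus_prod_def norm_Pair norm_real2)
  define admissible where "admissible \<mu> w z \<longleftrightarrow> \<bar>\<mu>\<bar> < \<delta> \<and> \<bar>w - w0\<bar> \<le> \<epsilon> \<and> z 0 = (vector [c, 0], vector [0, w]) \<and>
      (\<forall>t. (z has_vector_derivative newton (h \<mu>) (z t)) (at t))" for \<mu> w z
  have adm: "\<bar>norm (fst (z t)) - R\<bar> \<le> e" "norm (snd (z t)) \<le> R * \<omega> + 1" "0 < c * cross (fst (z t)) (snd (z t))"
      "0 < t \<Longrightarrow> 0 < fst (z t) $ 2" "\<omega> * t = pi / 4 \<Longrightarrow> 0 < c * fst (z t) $ 1"
      "\<omega> * t = 3 * pi / 4 \<Longrightarrow> c * fst (z t) $ 1 < 0"
    if z: "admissible \<mu> w z" and t: "0 \<le> t" "t \<le> T" for \<mu> w z t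
  proof -
    have \<mu>: "\<bar>\<mu>\<bar> < \<delta>" and w: "\<bar>w - w0\<bar> \<le> \<epsilon>" and zi: "z 0 = (vector [c, 0], vector [0, w])"
      and zd: "\<And>t. (z has_vector_derivative newton (h \<mu>) (z t)) (at t)"
      using z unfolding admissible_def by auto
    have close: "norm (z t - circular_orbit c R \<omega> t) \<le> e" if "0 \<le> t" "\<omega> * t \<le> 3 * pi / 4" for t
    proof -
      have "norm (z t - circular_orbit c R \<omega> t) \<le> K * (norm (z 0 - circular_orbit c R \<omega> 0) + \<epsilon>' * T)"
        unfolding K_def
        by (rule newton_family_perturbation[OF M \<delta>(3)[OF \<mu>] _ zd circ])
          (use that \<open>0 < \<epsilon>'\<close> T_iff in auto)
      also have "norm (z 0 - circular_orbit c R \<omega> 0) = \<bar>w - w0\<bar>" unfolding zi circ0 by (rule init_diff)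
      also have "K * (\<bar>w - w0\<bar> + \<epsilon>' * T) \<le> K * \<epsilon> + K * (\<epsilon>' * T)"
        using w K by (simp add: algebra_simps)
      also have "\<dots> \<le> e" using \<open>K * \<epsilon> \<le> e / 2\<close> \<open>K * (\<epsilon>' * T) \<le> e / 2\<close> by linarith
      finally show ?thesis .
    qed
    have "fst (z 0) $ 2 = 0" by (simp add: zi)
    note nearly = nearly_circular_motion[OF c R(1) \<omega>(1) e newton_position_velocity(1)[OF zd] this]
    have t': "\<omega> * t \<le> 3 * pi / 4" using t T_iff by blast
    show "\<bar>norm (fst (z t)) - R\<bar> \<le> e" by (rule nearly(1)[OF _ t(1) t']) (rule close)
    show "norm (snd (z t)) \<le> R * \<omega> + 1" by (rule nearly(2)[OF _ t(1) t']) (rule close)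
    show "0 < c * cross (fst (z t)) (snd (z t))" by (rule nearly(3)[OF _ t(1) t']) (rule close)
    show "0 < fst (z t) $ 2" if "0 < t" by (rule nearly(4)[OF _ that t']) (rule close)
    show "0 < c * fst (z t) $ 1" if "\<omega> * t = pi / 4" by (rule nearly(5)[OF _ that]) (rule close)
    show "c * fst (z t) $ 1 < 0" if "\<omega> * t = 3 * pi / 4" by (rule nearly(6)[OF _ that]) (rule close)
  qed
  have inS: "z t \<in> S" if "admissible \<mu> w z" "0 \<le> t" "t \<le> T" for \<mu> w z t
    using adm(1,2)[OF that] e_le(1) by (simp add: S_def mem_Times_iff)
  have exists: "\<exists>z. z 0 = (vector [c, 0], vector [0, w]) \<and> (\<forall>t. (z has_vector_derivative newton (h \<mu>) (z t)) (at t))"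
    if \<mu>: "\<bar>\<mu>\<bar> < \<delta>" for \<mu> w
  proof -
    obtain M' where "M'-lipschitz_on UNIV (h \<mu>)" using lip[of \<mu>] \<mu> \<delta>(2) by auto
    from lipschitz_ode_global_existence[OF lipschitz_on_newton[OF this]] show ?thesis by metis
  qed
  have unperturbed: "c * runge_lenz \<kappa> (z t) = R\<^sup>2 * (w\<^sup>2 - w0\<^sup>2)"
    if z: "admissible 0 w z" and t: "0 \<le> t" "t \<le> T" for w z t
  proof -
    have zi: "z 0 = (vector [c, 0], vector [0, w])" using z by (simp add: admissible_def)
    have "runge_lenz \<kappa> (z t) = runge_lenz \<kappa> (z 0)"
    proof (rule runge_lenz_conserved[where f="h 0" and T=T])
      show "(z has_vector_derivative newton (h 0) (z t)) (at t)" for t using z by (simp add: admissible_def)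
      fix s assume s: "s \<in> {0..T}"
      show "fst (z s) \<noteq> 0" using S_nz inS[OF z] s by simp
      show "h 0 (fst (z s)) = - (\<kappa> / norm (fst (z s)) ^ 3) *\<^sub>R fst (z s)"
        by (rule kepler) (use adm(1)[OF z] s e_le(1) in force)
    qed (use t in auto)
    also have "runge_lenz \<kappa> (z 0) = c * w\<^sup>2 - \<kappa> * c / R"
      by (simp add: runge_lenz_def zi cross_def norm_real2 c power2_eq_square)
    also have "\<dots> = c * (w\<^sup>2 - w0\<^sup>2)" by (simp add: w0(2) algebra_simps)
    finally have "runge_lenz \<kappa> (z t) = c * (w\<^sup>2 - w0\<^sup>2)" .
    moreover have "c * c = R\<^sup>2" using c by (metis abs_mult_self_eq power2_eq_square)
    ultimately show ?thesis by (metis mult.assoc)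
  qed
  have perturbed: "\<bar>c * runge_lenz \<kappa> (z t) - R\<^sup>2 * (w\<^sup>2 - w0\<^sup>2)\<bar> < m"
    if z: "admissible \<mu> w z" and t: "0 \<le> t" "t \<le> T" for \<mu> w z t
  proof -
    obtain y where y: "y 0 = (vector [c, 0], vector [0, w])" "\<forall>t. (y has_vector_derivative newton (h 0) (y t)) (at t)"
      using exists[of 0 w] \<delta>(1) by auto
    then have ya: "admissible 0 w y" using z \<delta>(1) by (simp add: admissible_def)
    have "norm (z t - y t) \<le> K * (norm (z 0 - y 0) + \<epsilon>' * T)"
      unfolding K_def
      by (rule newton_family_perturbation[OF M, where f="h \<mu>"])
        (use z y t \<delta>(3) \<open>0 < \<epsilon>'\<close> in \<open>auto simp: admissible_def\<close>)
    also have "z 0 - y 0 = 0" using z y by (simp add: admissible_def)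
    finally have "dist (z t) (y t) < \<gamma>" using \<open>K * (\<epsilon>' * T) < \<gamma>\<close> by (simp add: dist_norm)
    from \<gamma>(2)[OF inS[OF ya t] inS[OF z t] this] show ?thesis by (simp add: unperturbed[OF ya t])
  qed
  have "\<exists>w z \<tau>. \<bar>w - w0\<bar> \<le> \<eta> \<and> z 0 = (vector [c, 0], vector [0, w]) \<and>
        (\<forall>t. (z has_vector_derivative newton (h \<mu>) (z t)) (at t)) \<and>
        0 < \<tau> \<and> fst (z \<tau>) $ 1 = 0 \<and> snd (z \<tau>) $ 2 = 0 \<and>
        (\<forall>t. 0 \<le> t \<longrightarrow> t \<le> \<tau> \<longrightarrow> \<bar>norm (fst (z t)) - R\<bar> \<le> d \<and> 0 < c * cross (fst (z t)) (snd (z t))) \<and>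
        (\<forall>t. 0 < t \<longrightarrow> t \<le> \<tau> \<longrightarrow> 0 < fst (z t) $ 2)" if \<mu>: "\<bar>\<mu>\<bar> < \<delta>" for \<mu>
  proof -
    obtain Z where Z0: "\<And>w. Z w 0 = (vector [c, 0], vector [0, w])"
      and Z: "\<And>w t. (Z w has_vector_derivative newton (h \<mu>) (Z w t)) (at t)"
      using exists[OF \<mu>] by metis
    define t1 where "t1 = pi / (4 * \<omega>)"
    have t1: "0 < t1" "t1 \<le> T" "\<omega> * t1 = pi / 4" using \<omega>(1) by (simp_all add: t1_def T_def field_simps)
    have Ta: "\<omega> * T = 3 * pi / 4" using \<omega>(1) by (simp add: T_def)
    define W where "W = {w0 - \<epsilon>..w0 + \<epsilon>}"
    have adm_Z: "admissible \<mu> w (Z w)" if "w \<in> W" for w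
      using that \<mu> Z0 Z by (auto simp: admissible_def W_def abs_if)
    obtain M' where M': "M'-lipschitz_on UNIV (h \<mu>)" using lip[of \<mu>] \<mu> \<delta>(2) by auto
    have "continuous_on W (\<lambda>w. Z w 0)"
      unfolding continuous_on_iff Z0 dist_norm init_diff by auto
    then have contZ: "continuous_on ({t1..T} \<times> W) (\<lambda>p. Z (snd p) (fst p))"
      by (rule continuous_on_lipschitz_flow[OF lipschitz_on_newton[OF M'] Z]) (use t1 in simp)
    define X where "X p = - (c * fst (Z (snd p) (fst p)) $ 1)" for p
    define A where "A p = c * runge_lenz \<kappa> (Z (snd p) (fst p))" for p
    have cont_X: "continuous_on ({t1..T} \<times> W) X"
      unfolding X_def by (intro continuous_intros contZ)
    have cont_A: "continuous_on ({t1..T} \<times> W) A"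
      unfolding A_def
      by (rule continuous_on_compose2[OF contE contZ]) (use inS[OF adm_Z] t1 in auto)
    have X_sign: "X (t1, w) \<le> 0" "0 \<le> X (T, w)" if "w \<in> W" for w
      using adm(5)[OF adm_Z[OF that], of t1] adm(6)[OF adm_Z[OF that], of T] t1 T Ta
      by (simp_all add: X_def)
    have A_low: "A (t, w0 - \<epsilon>) \<le> 0" if "t \<in> {t1..T}" for t
    proof -
      have "w0 - \<epsilon> \<in> W" using \<open>0 < \<epsilon>\<close> by (simp add: W_def)
      then have "\<bar>c * runge_lenz \<kappa> (Z (w0 - \<epsilon>) t) - R\<^sup>2 * ((w0 - \<epsilon>)\<^sup>2 - w0\<^sup>2)\<bar> < m"
        by (intro perturbed[OF adm_Z]) (use that t1 in auto)
      moreover have "R\<^sup>2 * ((w0 - \<epsilon>)\<^sup>2 - w0\<^sup>2) \<le> - m"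
      proof -
        have "\<epsilon> * \<epsilon> \<le> \<epsilon> * w0" using \<epsilon>_le(2) w0(1) \<open>0 < \<epsilon>\<close> by (intro mult_left_mono) auto
        then have "(w0 - \<epsilon>)\<^sup>2 - w0\<^sup>2 \<le> - (\<epsilon> * w0)" by (simp add: power2_eq_square algebra_simps)
        then have "R\<^sup>2 * ((w0 - \<epsilon>)\<^sup>2 - w0\<^sup>2) \<le> R\<^sup>2 * (- (\<epsilon> * w0))" by (intro mult_left_mono) auto
        then show ?thesis by (simp add: m_def)
      qed
      ultimately show ?thesis by (simp add: A_def)
    qed
    have A_high: "0 \<le> A (t, w0 + \<epsilon>)" if "t \<in> {t1..T}" for t
    proof -
      have "w0 + \<epsilon> \<in> W" using \<open>0 < \<epsilon>\<close> by (simp add: W_def)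
      then have "\<bar>c * runge_lenz \<kappa> (Z (w0 + \<epsilon>) t) - R\<^sup>2 * ((w0 + \<epsilon>)\<^sup>2 - w0\<^sup>2)\<bar> < m"
        by (intro perturbed[OF adm_Z]) (use that t1 in auto)
      moreover have "m \<le> R\<^sup>2 * ((w0 + \<epsilon>)\<^sup>2 - w0\<^sup>2)"
      proof -
        have "0 \<le> \<epsilon> * \<epsilon> + \<epsilon> * w0" using w0(1) \<open>0 < \<epsilon>\<close> by simp
        then have "\<epsilon> * w0 \<le> (w0 + \<epsilon>)\<^sup>2 - w0\<^sup>2" by (simp add: power2_eq_square algebra_simps)
        then show ?thesis unfolding m_def by (intro mult_left_mono) auto
      qed
      ultimately show ?thesis by (simp add: A_def)
    qed
    obtain \<tau> w where \<tau>: "\<tau> \<in> {t1..T}" and w: "w \<in> W"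
      and "X (\<tau>, w) = 0" "A (\<tau>, w) = 0"
    proof (rule poincare_miranda_rectangle[of t1 T "w0 - \<epsilon>" "w0 + \<epsilon>" X A])
      show "w0 - \<epsilon> \<le> w0 + \<epsilon>" using \<open>0 < \<epsilon>\<close> by simp
    qed (use cont_X cont_A X_sign A_low A_high t1(2) that in \<open>auto simp: W_def\<close>)
    then have zero: "fst (Z w \<tau>) $ 1 = 0" "runge_lenz \<kappa> (Z w \<tau>) = 0" using c R(1) by (auto simp: X_def A_def)
    have "cross (fst (Z w \<tau>)) (snd (Z w \<tau>)) \<noteq> 0" using adm(3)[OF adm_Z[OF w], of \<tau>] \<tau> t1 by auto
    then have "snd (Z w \<tau>) $ 2 = 0" using zero by (simp add: runge_lenz_def)
    moreover have "\<bar>norm (fst (Z w t)) - R\<bar> \<le> d \<and> 0 < c * cross (fst (Z w t)) (snd (Z w t))"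
      if "0 \<le> t" "t \<le> \<tau>" for t
      using adm(1,3)[OF adm_Z[OF w], of t] that \<tau> e_le(1) by auto
    moreover have "0 < fst (Z w t) $ 2" if "0 < t" "t \<le> \<tau>" for t
      using adm(4)[OF adm_Z[OF w], of t] that \<tau> by auto
    moreover have "\<bar>w - w0\<bar> \<le> \<eta>" using w \<epsilon>_le(1) by (auto simp: W_def)
    moreover have "0 < \<tau>" using \<tau> t1 by auto
    ultimately show ?thesis using zero(1) Z0 Z by blast
  qed
  then show thesis using that[OF \<delta>(1,2)] unfolding w0_def by blast
qed

section \<open>Periodic orbits near the circle\<close>

theorem theorem0p1:
  fixes R a \<kappa> :: real
    and x0 :: "real^2"
    and U :: "(real^2) set"
    and g :: "real^2 \<Rightarrow> real \<Rightarrow> real^2"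
  assumes "R > 0"
    and "x0 \<in> sphere 0 R" and "x0 $ 2 = 0"
    and "open U" and "sphere 0 R \<subseteq> U" and "U \<subseteq> UNIV - {0}"
    and "a > 0"
    and "continuous_on (U \<times> {-a<..<a}) (\<lambda>(r, \<mu>). g r \<mu>)"
    and "\<kappa> > 0" and "\<forall>r\<in>U. g r 0 = - (\<kappa> / norm r ^ 3) *\<^sub>R r"
    and "\<forall>\<mu>\<in>{-a<..<a}. C1_on (\<lambda>r. g r \<mu>) U"
    and "\<phi>1 ` U = U" and "\<phi>2 ` U = U"
    and "\<forall>\<mu>\<in>{-a<..<a}. \<forall>r\<in>U. g (\<phi>1 r) \<mu> = \<phi>1 (g r \<mu>) \<and> g (\<phi>2 r) \<mu> = \<phi>2 (g r \<mu>)"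
  shows "(\<exists>\<delta>0. 0 < \<delta>0 \<and> \<delta>0 < a \<and>
            (\<forall>\<mu>\<in>{-\<delta>0<..<\<delta>0}. \<exists>v r. global_solution (\<lambda>p. g p \<mu>) U x0 v r \<and> periodic r))
       \<and> (\<forall>\<eta>>0. \<exists>\<delta>0 v. 0 < \<delta>0 \<and> \<delta>0 < a \<and>
            (\<forall>\<mu>\<in>{-\<delta>0<..<\<delta>0}.
               \<exists>r. global_solution (\<lambda>p. g p \<mu>) U x0 (v \<mu>) r \<and> periodic r \<and>
                   simple_closed_curve (range r) \<and>
                   \<phi>1 ` range r = range r \<and> \<phi>2 ` range r = range r \<and>
                   encloses (range r) 0) \<and>
            (\<forall>\<mu>\<in>{-\<delta>0<..<\<delta>0}. \<forall>\<mu>'\<in>{-\<delta>0<..<\<delta>0}. norm (v \<mu> - v \<mu>') < \<eta>))"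
proof -
  define c where "c = x0 $ 1"
  have x0: "x0 = vector [c, 0]"
    using assms(3) by (simp add: c_def vec_eq_iff forall_2)
  have c: "\<bar>c\<bar> = R"
    using assms(2) by (simp add: x0 norm_real2)
  obtain d where d: "0 < d" "2 * d < R" "\<And>p. \<bar>norm p - R\<bar> \<le> 2 * d \<Longrightarrow> p \<in> U"
    using annulus_in_neighbourhood_of_circle[OF assms(4,5,1)] by metis
  have C1: "C1_on (\<lambda>p. g p \<mu>) U" if "\<bar>\<mu>\<bar> < a" for \<mu>
    using assms(11) that by (auto simp: abs_less_iff)
  have g_sym: "g (\<phi>1 p) \<mu> = \<phi>1 (g p \<mu>) \<and> g (\<phi>2 p) \<mu> = \<phi>2 (g p \<mu>)" if "\<bar>\<mu>\<bar> < a" "p \<in> U" for \<mu> p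
  proof -
    have "\<mu> \<in> {-a<..<a}" using that(1) by (simp add: abs_less_iff)
    with assms(14) that(2) show ?thesis by blast
  qed
  obtain h where h_eq: "\<And>\<mu> p. \<bar>norm p - R\<bar> \<le> d \<Longrightarrow> h \<mu> p = g p \<mu>"
    and h_lip: "\<And>\<mu>. \<bar>\<mu>\<bar> < a \<Longrightarrow> \<exists>M. M-lipschitz_on UNIV (h \<mu>)"
    and h_sym: "\<And>\<mu> p. \<bar>\<mu>\<bar> < a \<Longrightarrow> h \<mu> (\<phi>1 p) = \<phi>1 (h \<mu> p) \<and> h \<mu> (\<phi>2 p) = \<phi>2 (h \<mu> p)"
    and h_near: "\<And>\<epsilon>. 0 < \<epsilon> \<Longrightarrow>
        \<exists>\<delta>. 0 < \<delta> \<and> \<delta> < a \<and> (\<forall>\<mu>. \<bar>\<mu>\<bar> < \<delta> \<longrightarrow> (\<forall>p. norm (h \<mu> p - h 0 p) \<le> \<epsilon>))"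
  proof -
    show thesis
      by (rule annular_extension_of_family[of a d U R g]) (fact assms(4,7,8) d(1,3) C1 g_sym that)+
  qed
  have kepler: "h 0 p = - (\<kappa> / norm p ^ 3) *\<^sub>R p" if "\<bar>norm p - R\<bar> \<le> d" for p
    using h_eq[OF that] assms(10) d(3)[of p] that d(1) by auto
  have d_less: "d < R" using d(1,2) by linarith
  define good where "good \<mu> v \<longleftrightarrow>
      (\<exists>r. global_solution (\<lambda>p. g p \<mu>) U x0 v r \<and> periodic r \<and> simple_closed_curve (range r) \<and>
        \<phi>1 ` range r = range r \<and> \<phi>2 ` range r = range r \<and> encloses (range r) 0)" for \<mu> v
  have main: "\<exists>\<delta>. 0 < \<delta> \<and> \<delta> < a \<and> (\<forall>\<mu>. \<bar>\<mu>\<bar> < \<delta> \<longrightarrow>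
      (\<exists>v. norm (v - vector [0, sqrt (\<kappa> / R)]) \<le> \<eta> \<and> good \<mu> v))" if "0 < \<eta>" for \<eta>
  proof -
    obtain \<delta> where \<delta>: "0 < \<delta>" "\<delta> < a"
      and shoot: "\<And>\<mu>. \<bar>\<mu>\<bar> < \<delta> \<Longrightarrow> \<exists>w z \<tau>. \<bar>w - sqrt (\<kappa> / R)\<bar> \<le> \<eta> \<and> z 0 = (vector [c, 0], vector [0, w]) \<and>
        (\<forall>t. (z has_vector_derivative newton (h \<mu>) (z t)) (at t)) \<and>
        0 < \<tau> \<and> fst (z \<tau>) $ 1 = 0 \<and> snd (z \<tau>) $ 2 = 0 \<and>
        (\<forall>t. 0 \<le> t \<longrightarrow> t \<le> \<tau> \<longrightarrow> \<bar>norm (fst (z t)) - R\<bar> \<le> d \<and> 0 < c * cross (fst (z t)) (snd (z t))) \<and>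
        (\<forall>t. 0 < t \<longrightarrow> t \<le> \<tau> \<longrightarrow> 0 < fst (z t) $ 2)"
    proof -
      show thesis
        by (rule shooting_from_axis_to_axis[of R d \<kappa> c a h \<eta>])
          (fact assms(1,7,9) d(1) d_less c h_lip kepler h_near \<open>0 < \<eta>\<close> that)+
    qed
    have "\<exists>v. norm (v - vector [0, sqrt (\<kappa> / R)]) \<le> \<eta> \<and> good \<mu> v" if \<mu>: "\<bar>\<mu>\<bar> < \<delta>" for \<mu>
    proof -
      obtain w z \<tau> where w: "\<bar>w - sqrt (\<kappa> / R)\<bar> \<le> \<eta>" and z0: "z 0 = (vector [c, 0], vector [0, w])"
        and z: "\<And>t. (z has_vector_derivative newton (h \<mu>) (z t)) (at t)"
        and \<tau>: "0 < \<tau>" "fst (z \<tau>) $ 1 = 0" "snd (z \<tau>) $ 2 = 0"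
        and ann: "\<And>t. 0 \<le> t \<Longrightarrow> t \<le> \<tau> \<Longrightarrow> \<bar>norm (fst (z t)) - R\<bar> \<le> d"
        and spin: "\<And>t. 0 \<le> t \<Longrightarrow> t \<le> \<tau> \<Longrightarrow> 0 < c * cross (fst (z t)) (snd (z t))"
        and up: "\<And>t. 0 < t \<Longrightarrow> t \<le> \<tau> \<Longrightarrow> 0 < fst (z t) $ 2"
        using shoot[OF \<mu>] by metis
      have \<mu>a: "\<bar>\<mu>\<bar> < a" using \<mu> \<delta>(2) by linarith
      obtain M where M: "M-lipschitz_on UNIV (h \<mu>)" using h_lip[OF \<mu>a] by blast
      have start: "fst (z 0) $ 2 = 0" "snd (z 0) $ 1 = 0" "fst (z 0) $ 1 = c"
        by (simp_all add: z0)
      note orbit = orbit_from_perpendicular_crossings[OF M conjunct1[OF h_sym[OF \<mu>a]] conjunct2[OF h_sym[OF \<mu>a]]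
          z start(1,2) \<tau> up, unfolded start(3), OF _ _ spin]
      define r where "r t = fst (z t)" for t
      have r: "r = (\<lambda>t. fst (z t))" by (simp add: r_def fun_eq_iff)
      have in_annulus: "\<bar>norm (r t) - R\<bar> \<le> d" for t
      proof -
        obtain s where "s \<in> {0..\<tau>}" "norm (fst (z t)) = norm (fst (z s))"
          using orbit(1) by blast
        then show ?thesis using ann[of s] by (simp add: r_def)
      qed
      have "global_solution (\<lambda>p. g p \<mu>) U x0 (vector [0, w]) r"
        unfolding global_solution_def
      proof (intro conjI allI exI[of _ "\<lambda>t. snd (z t)"])
        show "r t \<in> U" for t using d(1) d(3)[of "r t"] in_annulus[of t] by simp
        show "r 0 = x0" "snd (z 0) = vector [0, w]" by (simp_all add: r_def z0 x0)
        show "(r has_vector_derivative snd (z t)) (at t)" for t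
          unfolding r by (rule newton_position_velocity(1)[OF z])
        show "((\<lambda>t. snd (z t)) has_vector_derivative g (r t) \<mu>) (at t)" for t
          using newton_position_velocity(2)[OF z, of t] h_eq[OF in_annulus[of t]] by (simp add: r_def)
      qed
      then have "good \<mu> (vector [0, w])"
        unfolding good_def using orbit(2-6) r by blast
      moreover have "norm (vector [0, w] - vector [0, sqrt (\<kappa> / R)] :: real^2) = \<bar>w - sqrt (\<kappa> / R)\<bar>"
        by (simp add: norm_real2)
      ultimately show ?thesis using w by metis
    qed
    then show ?thesis using \<delta> by blast
  qed
  have close: "\<exists>\<delta>0 v. 0 < \<delta>0 \<and> \<delta>0 < a \<and> (\<forall>\<mu>\<in>{-\<delta>0<..<\<delta>0}. good \<mu> (v \<mu>)) \<and>
      (\<forall>\<mu>\<in>{-\<delta>0<..<\<delta>0}. \<forall>\<mu>'\<in>{-\<delta>0<..<\<delta>0}. norm (v \<mu> - v \<mu>') < \<eta>)" if "0 < \<eta>" for \<eta> :: real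
  proof -
    obtain \<delta> where \<delta>: "0 < \<delta>" "\<delta> < a" "\<forall>\<mu>. \<bar>\<mu>\<bar> < \<delta> \<longrightarrow>
        (\<exists>v. norm (v - vector [0, sqrt (\<kappa> / R)]) \<le> \<eta> / 3 \<and> good \<mu> v)"
      using main[of "\<eta> / 3"] \<open>0 < \<eta>\<close> by auto
    then obtain v where v: "\<And>\<mu>. \<bar>\<mu>\<bar> < \<delta> \<Longrightarrow> norm (v \<mu> - vector [0, sqrt (\<kappa> / R)]) \<le> \<eta> / 3 \<and> good \<mu> (v \<mu>)"
      by metis
    have "norm (v \<mu> - v \<mu>') < \<eta>" if "\<bar>\<mu>\<bar> < \<delta>" "\<bar>\<mu>'\<bar> < \<delta>" for \<mu> \<mu>'
      using norm_triangle_ineq4[of "v \<mu> - vector [0, sqrt (\<kappa> / R)]" "v \<mu>' - vector [0, sqrt (\<kappa> / R)]"]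
        v[OF that(1)] v[OF that(2)] \<open>0 < \<eta>\<close> by simp
    then show ?thesis using \<delta>(1,2) v by (intro exI[of _ \<delta>] exI[of _ v]) (auto simp: abs_less_iff)
  qed
  show ?thesis
  proof
    obtain \<delta> v where "0 < \<delta>" "\<delta> < a" "\<forall>\<mu>\<in>{-\<delta><..<\<delta>}. good \<mu> (v \<mu>)"
      using close[of 1] by auto
    then show "\<exists>\<delta>0. 0 < \<delta>0 \<and> \<delta>0 < a \<and>
        (\<forall>\<mu>\<in>{-\<delta>0<..<\<delta>0}. \<exists>v r. global_solution (\<lambda>p. g p \<mu>) U x0 v r \<and> periodic r)"
      unfolding good_def by blast
  qed (use close in \<open>unfold good_def, blast\<close>)
qed

end
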